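(* Let $\mathbf{T}=(\mathcal{V},\mathcal{E})$ be a countable tree and let $\alpha>0$. Then there exists an infinite volume rate $\alpha$ PCF process on $\mathbf{T}$; that is, there is a process $(\eta^t)_{t\in[0,\infty]}$ with values in $\{w,f\}^{\mathcal{V}}\times\{0,1\}^{\mathcal{E}}$ such that for every finite subgraph $\mathbf{\Lambda}\subseteq\mathbf{T}$ and every exhaustion $\mathbf{G}_1\subseteq\mathbf{G}_2\subseteq\cdots$ of $\mathbf{T}$ by finite connected subgraphs, the restriction to $\mathbf{\Lambda}$ of the rate $\alpha$ PCF process on $\mathbf{G}_n$ converges in law, as $n\to\infty$, to the restriction of $(\eta^t)_{t\in[0,\infty]}$ to $\mathbf{\Lambda}$. This induces the PCF measure $\mu_{\mathbf{T},\alpha}$ on $\{0,1\}^{\mathcal{E}}$ (the law of the edge configuration of $\eta^\infty$).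
   Context: An exhaustion of $\mathbf{T}$ by finite connected subgraphs is an increasing sequence of finite connected subgraphs such that every finite subgraph of $\mathbf{T}$ is contained in $\mathbf{G}_n$ for all large $n$. Percolation with constant freezing (PCF) at rate $\alpha>0$ on a finite graph $\mathbf{H}=(\mathcal{V}_{\mathbf{H}},\mathcal{E}_{\mathbf{H}})$ is the continuous-time Markov chain $(\eta^t)_{t\ge 0}$ on $\{w,f\}^{\mathcal{V}_{\mathbf{H}}}\times\{0,1\}^{\mathcal{E}_{\mathbf{H}}}$ in which vertices are warm ($w$) or frozen ($f$) and edges are open ($1$) or closed ($0$). Initially all vertices are warm and all edges closed. The clusters of a configuration are the connected components of the graph formed by all vertices and the open edges (isolated vertices count as clusters; openness of paths ignores whether vertices are warm or frozen). Transitions: each closed edge whose two end vertices are both warm opens at rate $1$; each cluster $C$ freezes at rate $\alpha$ (all vertices of $C$ are set to $f$); there are no other transitions. The chain reaches a final configuration $\eta^\infty$ in finite time, so the process is indexed by $t\in[0,\infty]$. The restriction of a process to $\mathbf{\Lambda}$ records the states of the vertices and edges of $\mathbf{\Lambda}$ at all times $t\in[0,\infty]$. *)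

theory Defs
  imports "HOL-Probability.Probability"
begin

section \<open>Simple graphs, trees, exhaustions\<close>

record 'a ugraph =
  verts :: "'a set"
  edges :: "'a set set"

definition simple_graph :: "'a ugraph \<Rightarrow> bool" where
  "simple_graph G \<longleftrightarrow> (\<forall>e\<in>edges G. e \<subseteq> verts G \<and> card e = 2)"

definition adj :: "'a ugraph \<Rightarrow> 'a \<Rightarrow> 'a \<Rightarrow> bool" where
  "adj G u v \<longleftrightarrow> {u, v} \<in> edges G"

definition connected_graph :: "'a ugraph \<Rightarrow> bool" where
  "connected_graph G \<longleftrightarrow> verts G \<noteq> {} \<and> (\<forall>u\<in>verts G. \<forall>v\<in>verts G. (adj G)\<^sup>*\<^sup>* u v)"

definition cycle :: "'a ugraph \<Rightarrow> 'a list \<Rightarrow> bool" where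
  "cycle G p \<longleftrightarrow> 3 \<le> length p \<and> distinct p \<and>
     (\<forall>i<length p. adj G (p ! i) (p ! (Suc i mod length p)))"

definition tree :: "'a ugraph \<Rightarrow> bool" where
  "tree G \<longleftrightarrow> simple_graph G \<and> connected_graph G \<and> (\<nexists>p. cycle G p)"

definition components :: "'a ugraph \<Rightarrow> 'a set set" where
  "components G = (\<lambda>v. {u \<in> verts G. (adj G)\<^sup>*\<^sup>* v u}) ` verts G"

definition finite_graph :: "'a ugraph \<Rightarrow> bool" where
  "finite_graph G \<longleftrightarrow> finite (verts G) \<and> finite (edges G)"

text \<open>Subgraphs need not be induced.\<close>

definition subgraph :: "'a ugraph \<Rightarrow> 'a ugraph \<Rightarrow> bool" where
  "subgraph H G \<longleftrightarrow> simple_graph H \<and> verts H \<subseteq> verts G \<and> edges H \<subseteq> edges G"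

definition exhaustion :: "'a ugraph \<Rightarrow> (nat \<Rightarrow> 'a ugraph) \<Rightarrow> bool" where
  "exhaustion T G \<longleftrightarrow>
     (\<forall>n. subgraph (G n) T \<and> finite_graph (G n) \<and> connected_graph (G n)) \<and>
     (\<forall>n. subgraph (G n) (G (Suc n))) \<and>
     (\<forall>L. subgraph L T \<and> finite_graph L \<longrightarrow> (\<forall>\<^sub>F n in sequentially. subgraph L (G n)))"


section \<open>Continuous-time Markov chains on a finite state space\<close>

text \<open>
  Rates are given by a function \<open>q\<close>, where \<open>q x y\<close> is the total rate of the transitions leading
  from \<open>x\<close> to \<open>y\<close>. Transitions from \<open>x\<close> to itself have no effect: \<open>q x x\<close> cancels in the
  generator.
\<close>

definition generator :: "'s set \<Rightarrow> ('s \<Rightarrow> 's \<Rightarrow> real) \<Rightarrow> 's \<Rightarrow> 's \<Rightarrow> real" where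
  "generator S q x y = q x y - of_bool (x = y) * (\<Sum>z\<in>S. q x z)"

primrec kernel_power :: "'s set \<Rightarrow> ('s \<Rightarrow> 's \<Rightarrow> real) \<Rightarrow> nat \<Rightarrow> 's \<Rightarrow> 's \<Rightarrow> real" where
  "kernel_power S A 0 x y = of_bool (x = y)"
| "kernel_power S A (Suc n) x y = (\<Sum>z\<in>S. A x z * kernel_power S A n z y)"

text \<open>The transition function is the matrix exponential of \<open>t\<close> times the generator.\<close>

definition transition_prob ::
    "'s set \<Rightarrow> ('s \<Rightarrow> 's \<Rightarrow> real) \<Rightarrow> real \<Rightarrow> 's \<Rightarrow> 's \<Rightarrow> real" where
  "transition_prob S q t x y = (\<Sum>n. t ^ n / fact n * kernel_power S (generator S q) n x y)"

text \<open>
  Time is \<open>[0,\<infinity>]\<close>, i.e. the type \<^typ>\<open>ennreal\<close>. Paths take values in a discrete space, so limits are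
  expressed by being eventually constant. The filters \<open>at_left 0\<close> and \<open>at_right \<infinity>\<close> are trivial.
\<close>

definition cadlag :: "(ennreal \<Rightarrow> 's) \<Rightarrow> bool" where
  "cadlag x \<longleftrightarrow> (\<forall>t. (\<forall>\<^sub>F s in at_right t. x s = x t) \<and> (\<exists>c. \<forall>\<^sub>F s in at_left t. x s = c))"

definition cadlag_process ::
    "'s set \<Rightarrow> 'w measure \<Rightarrow> (ennreal \<Rightarrow> 'w \<Rightarrow> 's) \<Rightarrow> bool" where
  "cadlag_process S M X \<longleftrightarrow> prob_space M \<and>
     (\<forall>t. X t \<in> M \<rightarrow>\<^sub>M count_space S) \<and> (\<forall>\<omega>\<in>space M. cadlag (\<lambda>t. X t \<omega>))"

text \<open>
  The Markov property together with the law of the initial state is expressed by the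
  finite-dimensional distributions; the value at time \<open>\<infinity>\<close> is the final state.
\<close>

definition markov_chain ::
    "'s set \<Rightarrow> ('s \<Rightarrow> 's \<Rightarrow> real) \<Rightarrow> 's \<Rightarrow> 'w measure \<Rightarrow> (ennreal \<Rightarrow> 'w \<Rightarrow> 's) \<Rightarrow> bool" where
  "markov_chain S q x\<^sub>0 M X \<longleftrightarrow>
     cadlag_process S M X \<and>
     (\<forall>k (t :: nat \<Rightarrow> real) x.
        0 \<le> t 0 \<and> (\<forall>i<k. t i \<le> t (Suc i)) \<and> (\<forall>i\<le>k. x i \<in> S) \<longrightarrow>
        measure M {\<omega> \<in> space M. \<forall>i\<le>k. X (ennreal (t i)) \<omega> = x i} =
          transition_prob S q (t 0) x\<^sub>0 (x 0) *
          (\<Prod>i<k. transition_prob S q (t (Suc i) - t i) (x i) (x (Suc i)))) \<and>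
     (AE \<omega> in M. \<forall>\<^sub>F s in at_left \<infinity>. X s \<omega> = X \<infinity> \<omega>)"


section \<open>Convergence in law of cadlag processes\<close>

text \<open>
  Convergence in the Skorokhod (J1) topology on the cadlag paths \<open>[0,\<infinity>] \<rightarrow> S\<close> for discrete \<open>S\<close>.
  The time changes \<open>\<tau> n\<close> are the increasing homeomorphisms of the compact interval \<open>[0,\<infinity>]\<close>; as they
  are monotone and the identity is continuous, their pointwise convergence to the identity is
  uniform.
\<close>

definition skorokhod_tendsto :: "(nat \<Rightarrow> ennreal \<Rightarrow> 's) \<Rightarrow> (ennreal \<Rightarrow> 's) \<Rightarrow> bool" where
  "skorokhod_tendsto xs x \<longleftrightarrow>
     (\<exists>\<tau> :: nat \<Rightarrow> ennreal \<Rightarrow> ennreal.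
        (\<forall>n. strict_mono (\<tau> n) \<and> surj (\<tau> n)) \<and>
        (\<forall>t. (\<lambda>n. \<tau> n t) \<longlonglongrightarrow> t) \<and>
        (\<forall>\<^sub>F n in sequentially. \<forall>t. xs n (\<tau> n t) = x t))"

text \<open>The J1 topology is metrizable, so continuity may be tested on sequences.\<close>

definition skorokhod_continuous :: "'s set \<Rightarrow> ((ennreal \<Rightarrow> 's) \<Rightarrow> real) \<Rightarrow> bool" where
  "skorokhod_continuous S F \<longleftrightarrow>
     (\<forall>xs x. (\<forall>n. cadlag (xs n) \<and> range (xs n) \<subseteq> S) \<and> cadlag x \<and> range x \<subseteq> S \<and>
        skorokhod_tendsto xs x \<longrightarrow> (\<lambda>n. F (xs n)) \<longlonglongrightarrow> F x)"

text \<open>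
  Test functionals are defined on all of \<open>[0,\<infinity>] \<rightarrow> S\<close>, are measurable for the product sigma-algebra
  (whose trace on the cadlag paths is the Borel sigma-algebra of the J1 topology) and continuous
  on the cadlag paths.
\<close>

definition converges_in_law ::
    "'s set \<Rightarrow> (nat \<Rightarrow> 'v measure) \<Rightarrow> (nat \<Rightarrow> ennreal \<Rightarrow> 'v \<Rightarrow> 's) \<Rightarrow>
     'w measure \<Rightarrow> (ennreal \<Rightarrow> 'w \<Rightarrow> 's) \<Rightarrow> bool" where
  "converges_in_law S N Y M X \<longleftrightarrow>
     (\<forall>n. cadlag_process S (N n) (Y n)) \<and> cadlag_process S M X \<and>
     (\<forall>F. F \<in> borel_measurable (Pi\<^sub>M UNIV (\<lambda>_. count_space S)) \<and> bounded (range F) \<and>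
        skorokhod_continuous S F \<longrightarrow>
        (\<lambda>n. \<integral>\<omega>. F (\<lambda>t. Y n t \<omega>) \<partial>N n) \<longlonglongrightarrow> (\<integral>\<omega>. F (\<lambda>t. X t \<omega>) \<partial>M))"


section \<open>Percolation with constant freezing\<close>

datatype vstate = Warm | Frozen

text \<open>
  A configuration on \<open>H\<close> consists of extensional functions on \<open>verts H\<close> and \<open>edges H\<close>; an edge is
  open iff its state is \<open>True\<close>.
\<close>

type_synonym 'a config = "('a \<Rightarrow> vstate) \<times> ('a set \<Rightarrow> bool)"

definition configs :: "'a ugraph \<Rightarrow> 'a config set" where
  "configs H = (verts H \<rightarrow>\<^sub>E UNIV) \<times> (edges H \<rightarrow>\<^sub>E UNIV)"

definition edge_space :: "'a ugraph \<Rightarrow> ('a set \<Rightarrow> bool) measure" where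
  "edge_space H = (\<Pi>\<^sub>M e\<in>edges H. count_space UNIV)"

definition config_space :: "'a ugraph \<Rightarrow> 'a config measure" where
  "config_space H = (\<Pi>\<^sub>M v\<in>verts H. count_space UNIV) \<Otimes>\<^sub>M edge_space H"

definition restrict_config :: "'a ugraph \<Rightarrow> 'a config \<Rightarrow> 'a config" where
  "restrict_config L x = (restrict (fst x) (verts L), restrict (snd x) (edges L))"

definition initial_config :: "'a ugraph \<Rightarrow> 'a config" where
  "initial_config H = (\<lambda>v\<in>verts H. Warm, \<lambda>e\<in>edges H. False)"

definition clusters :: "'a ugraph \<Rightarrow> 'a config \<Rightarrow> 'a set set" where
  "clusters H x = components \<lparr>verts = verts H, edges = {e \<in> edges H. snd x e}\<rparr>"

definition openable :: "'a ugraph \<Rightarrow> 'a config \<Rightarrow> 'a set set" where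
  "openable H x = {e \<in> edges H. \<not> snd x e \<and> (\<forall>v\<in>e. fst x v = Warm)}"

definition open_edge :: "'a set \<Rightarrow> 'a config \<Rightarrow> 'a config" where
  "open_edge e x = (fst x, (snd x)(e := True))"

definition freeze :: "'a set \<Rightarrow> 'a config \<Rightarrow> 'a config" where
  "freeze C x = (\<lambda>v. if v \<in> C then Frozen else fst x v, snd x)"

definition PCF_rate :: "'a ugraph \<Rightarrow> real \<Rightarrow> 'a config \<Rightarrow> 'a config \<Rightarrow> real" where
  "PCF_rate H \<alpha> x y =
     (\<Sum>e\<in>openable H x. of_bool (y = open_edge e x)) +
     (\<Sum>C\<in>clusters H x. \<alpha> * of_bool (y = freeze C x))"

definition PCF_process ::
    "'a ugraph \<Rightarrow> real \<Rightarrow> 'w measure \<Rightarrow> (ennreal \<Rightarrow> 'w \<Rightarrow> 'a config) \<Rightarrow> bool" where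
  "PCF_process H \<alpha> M \<eta> \<longleftrightarrow> markov_chain (configs H) (PCF_rate H \<alpha>) (initial_config H) M \<eta>"

type_synonym 'a path = "ennreal \<Rightarrow> 'a config"

text \<open>
  The sample spaces \<open>N n\<close> of the finite-volume processes have points of type \<^typ>\<open>'a path\<close>. This is
  no restriction: every process is equal in law to the coordinate process on the space of its
  paths, and convergence in law only depends on the laws. For those \<open>n\<close> for which \<open>L\<close> is
  not contained in \<open>G n\<close> the states of the missing vertices and edges are arbitrary constants.
\<close>

definition infinite_volume_PCF ::
    "'a ugraph \<Rightarrow> real \<Rightarrow> 'w measure \<Rightarrow> (ennreal \<Rightarrow> 'w \<Rightarrow> 'a config) \<Rightarrow> bool" where
  "infinite_volume_PCF T \<alpha> M \<eta> \<longleftrightarrow>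
     prob_space M \<and> (\<forall>t. \<eta> t \<in> M \<rightarrow>\<^sub>M config_space T) \<and>
     (\<forall>L G (N :: nat \<Rightarrow> 'a path measure) \<xi>.
        subgraph L T \<and> finite_graph L \<and> exhaustion T G \<and>
        (\<forall>n. PCF_process (G n) \<alpha> (N n) (\<xi> n)) \<longrightarrow>
        converges_in_law (configs L)
          N (\<lambda>n t \<omega>. restrict_config L (\<xi> n t \<omega>))
          M (\<lambda>t \<omega>. restrict_config L (\<eta> t \<omega>)))"

definition PCF_measure :: "'a ugraph \<Rightarrow> real \<Rightarrow> ('a set \<Rightarrow> bool) measure \<Rightarrow> bool" where
  "PCF_measure T \<alpha> \<mu> \<longleftrightarrow>
     (\<exists>(M :: 'a path measure) \<eta>. infinite_volume_PCF T \<alpha> M \<eta> \<and>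
        \<mu> = distr M (edge_space T) (\<lambda>\<omega>. snd (\<eta> \<infinity> \<omega>)))"

end

theory Submission
  imports Defs
begin

text \<open>
  Root the tree at \<open>r\<close>, give every vertex \<open>v\<close> an exponential clock \<open>w {v}\<close> of rate \<open>\<alpha>\<close> and every
  edge \<open>e\<close> an exponential clock \<open>w e\<close> of rate 1, all independent. An edge opens when its clock rings
  provided that both ends are still warm, and a cluster freezes when the clock of its vertex closest
  to the root rings. As a vertex only feels its ancestors, the freezing times are determined by
  recursion along the path to the root, on an infinite tree as well as on a finite one, and the
  restriction of the resulting process to any connected subgraph containing \<open>r\<close> is the process built
  in the same way on that subgraph. On a finite tree this process is PCF, because the clocks that
  have not rung are memoryless and those that have rung have no further effect. Hence for large \<open>n\<close>
  the PCF process on \<open>G n\<close> has exactly the law of the restriction of the infinite process.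
\<close>

section \<open>The transition function solves the Kolmogorov equations\<close>

text \<open>Any rule that selects one vertex of each cluster from the present configuration yields
  freezing at rate \<alpha>, provided that the selected clock has not yet rung while the cluster is
  warm. Merging respects this: when an edge opens, the lower cluster gives up its unrung clock for
  good, and the clock of the upper one has not rung either, since both ends are warm. Transition
  probabilities are matrix exponentials, so memorylessness has to be turned into a differential
  equation. Stopping times and jump chains are avoided: for an event A of the past, the masses of A
  intersected with X t = y satisfy the forward Kolmogorov equation up to an error O(h^2) over a
  window of length h, and this equation has only one solution. Carrying A along gives the Markov
  property together with the one-time laws. The value at time \<infinity> is not covered by these
  identities and is recovered from left limits. Uniqueness of the measure is a separate matter:
  infinite volume processes are known only through their limits, so two of them are compared along
  one common exhaustion.\<close>

lemma kernel_power_bound: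
  assumes "finite S"
  obtains B :: real where "B > 0"
    "\<And>n x y. x \<in> S \<Longrightarrow> \<bar>kernel_power S A n x y\<bar> \<le> B ^ n"
proof -
  \<comment> \<open>The sum of all absolute entries dominates every row sum; the added 1 keeps
    \<open>B\<close> positive when that sum vanishes.\<close>
  define B where "B = 1 + (\<Sum>x\<in>S. \<Sum>z\<in>S. \<bar>A x z\<bar>)"
  have B: "B > 0"
    unfolding B_def by (intro add_pos_nonneg sum_nonneg) auto
  have row: "(\<Sum>z\<in>S. \<bar>A x z\<bar>) \<le> B" if "x \<in> S" for x
    using member_le_sum[OF that, of "\<lambda>x. \<Sum>z\<in>S. \<bar>A x z\<bar>"] assms
    by (simp add: B_def sum_nonneg)
  have "\<bar>kernel_power S A n x y\<bar> \<le> B ^ n" if "x \<in> S" for n x y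
    using that
  proof (induction n arbitrary: x)
    case (Suc n)
    have "\<bar>kernel_power S A (Suc n) x y\<bar> \<le> (\<Sum>z\<in>S. \<bar>A x z * kernel_power S A n z y\<bar>)"
      by simp
    also have "\<dots> \<le> (\<Sum>z\<in>S. \<bar>A x z\<bar> * B ^ n)"
      by (intro sum_mono) (simp add: abs_mult Suc.IH mult_left_mono)
    also have "\<dots> \<le> B * B ^ n"
      unfolding sum_distrib_right[symmetric] using row[OF Suc.prems] B by (intro mult_right_mono) auto
    finally show ?case by simp
  qed simp
  then show ?thesis using that B by blast
qed

lemma summable_kernel_power:
  assumes "finite S" "x \<in> S"
  shows "summable (\<lambda>n. kernel_power S A n x y / fact n * t ^ n)"
proof -
  obtain B :: real where B: "B > 0" "\<And>n x y. x \<in> S \<Longrightarrow> \<bar>kernel_power S A n x y\<bar> \<le> B ^ n"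
    using kernel_power_bound[OF assms(1)] by blast
  show ?thesis
  proof (rule summable_comparison_test'[where N = 0])
    show "summable (\<lambda>n. (B * \<bar>t\<bar>) ^ n /\<^sub>R fact n)" by (rule summable_exp_generic)
    show "norm (kernel_power S A n x y / fact n * t ^ n) \<le> (B * \<bar>t\<bar>) ^ n /\<^sub>R fact n" for n
      using B(2)[OF assms(2), of n y]
      by (simp add: abs_mult power_mult_distrib power_abs divide_simps mult_right_mono)
  qed
qed

lemma transition_prob_0:
  "transition_prob S q 0 x y = of_bool (x = y)"
proof -
  have "transition_prob S q 0 x y =
      (\<Sum>n. (if n = 0 then kernel_power S (generator S q) n x y else 0))"
    unfolding transition_prob_def by (intro suminf_cong) auto
  also have "\<dots> = (\<Sum>n\<in>{0::nat}. (if n = 0 then kernel_power S (generator S q) n x y else 0))"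
    by (rule suminf_finite) auto
  finally show ?thesis by simp
qed

text \<open>\<open>kernel_power\<close> peels its factors off on the left, so termwise
  differentiation produces the backward equation. Its forward counterpart will be demanded of the
  family \<open>p\<close> instead.\<close>

lemma transition_prob_backward:
  assumes "finite S" "x \<in> S"
  shows "((\<lambda>t. transition_prob S q t x y) has_real_derivative
           (\<Sum>z\<in>S. generator S q x z * transition_prob S q t z y)) (at t)"
proof -
  let ?K = "kernel_power S (generator S q)"
  let ?c = "\<lambda>x n. ?K n x y / fact n"
  have P: "transition_prob S q t x y = (\<Sum>n. ?c x n * t ^ n)" for t x
    unfolding transition_prob_def by (simp add: field_simps)
  have "((\<lambda>t. \<Sum>n. ?c x n * t ^ n) has_real_derivative (\<Sum>n. diffs (?c x) n * t ^ n)) (at t)"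
    using summable_kernel_power[OF assms] by (intro termdiffs_strong_converges_everywhere)
  moreover have "diffs (?c x) n * t ^ n = (\<Sum>z\<in>S. generator S q x z * (?c z n * t ^ n))" for n
  proof -
    have "diffs (?c x) n = ?K (Suc n) x y / fact n"
      by (simp add: diffs_def fact_Suc del: of_nat_Suc kernel_power.simps)
    then have "diffs (?c x) n * t ^ n = (\<Sum>z\<in>S. generator S q x z * ?K n z y / fact n) * t ^ n"
      by (simp add: sum_divide_distrib)
    then show ?thesis unfolding sum_distrib_right by (simp add: mult.assoc)
  qed
  moreover have "(\<Sum>n. \<Sum>z\<in>S. generator S q x z * (?c z n * t ^ n)) =
      (\<Sum>z\<in>S. generator S q x z * (\<Sum>n. ?c z n * t ^ n))"
    by (subst suminf_sum)
      (intro sum.cong refl suminf_mult summable_mult summable_kernel_power assms(1); assumption)+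
  ultimately show ?thesis by (simp only: P)
qed

lemma forward_equation_unique:
  assumes S: "finite S" and u: "s \<le> u" and z: "z \<in> S"
    and p: "\<And>t y. s \<le> t \<Longrightarrow> t \<le> u \<Longrightarrow> y \<in> S \<Longrightarrow>
      ((\<lambda>t. p t y) has_real_derivative (\<Sum>x\<in>S. p t x * generator S q x y)) (at t within {s..u})"
  shows "p u z = (\<Sum>y\<in>S. p s y * transition_prob S q (u - s) y z)"
proof -
  let ?P = "transition_prob S q" and ?A = "generator S q"
  \<comment> \<open>evolve by \<open>p\<close> up to time \<open>t\<close> and by the semigroup afterwards: the result does not depend on \<open>t\<close>\<close>
  define w where "w = (\<lambda>t. \<Sum>y\<in>S. p t y * ?P (u - t) y z)"
  have dw: "(w has_real_derivative 0) (at t within {s..u})" if t: "t \<in> {s..u}" for t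
  proof -
    have P: "((\<lambda>t. ?P (u - t) y z) has_real_derivative
        - (\<Sum>x\<in>S. ?A y x * ?P (u - t) x z)) (at t within {s..u})" if "y \<in> S" for y
    proof -
      have "((\<lambda>t. u - t) has_real_derivative -1) (at t within {s..u})"
        by (auto intro!: derivative_eq_intros)
      from DERIV_chain2[OF transition_prob_backward[OF S that] this] show ?thesis by simp
    qed
    have "(w has_real_derivative (\<Sum>y\<in>S. (\<Sum>x\<in>S. p t x * ?A x y) * ?P (u - t) y z
        + - (\<Sum>x\<in>S. ?A y x * ?P (u - t) x z) * p t y)) (at t within {s..u})"
      unfolding w_def using t by (intro DERIV_sum DERIV_mult p P) auto
    moreover have "(\<Sum>y\<in>S. (\<Sum>x\<in>S. p t x * ?A x y) * ?P (u - t) y z) =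
        (\<Sum>y\<in>S. (\<Sum>x\<in>S. ?A y x * ?P (u - t) x z) * p t y)"
      unfolding sum_distrib_right by (subst sum.swap) (simp add: mult_ac)
    ultimately show ?thesis by (simp add: sum.distrib sum_negf sum_subtractf)
  qed
  have "\<exists>c. \<forall>x\<in>{s..u}. w x = c"
    by (rule has_field_derivative_zero_constant) (use dw in auto)
  then have "w u = w s" using u by auto
  moreover have "w u = p u z"
    using S z by (simp add: w_def transition_prob_0 of_bool_def sum.delta' if_distrib cong: if_cong)
  ultimately show ?thesis by (simp add: w_def)
qed

lemma has_real_derivative_quadratic_error:
  fixes f :: "real \<Rightarrow> real"
  assumes "\<And>t'. t' \<in> T \<Longrightarrow> \<bar>f t' - f t - (t' - t) * D\<bar> \<le> K * (t' - t)\<^sup>2"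
  shows "(f has_real_derivative D) (at t within T)"
proof -
  have "((\<lambda>x. (f x - f t) / (x - t) - D) \<longlongrightarrow> 0) (at t within T)"
  proof (rule Lim_null_comparison)
    show "\<forall>\<^sub>F x in at t within T. norm ((f x - f t) / (x - t) - D) \<le> \<bar>K\<bar> * \<bar>x - t\<bar>"
    proof (unfold eventually_at_filter, intro always_eventually allI impI)
      fix x assume x: "x \<noteq> t" "x \<in> T"
      have "(f x - f t) / (x - t) - D = (f x - f t - (x - t) * D) / (x - t)"
        using x by (simp add: field_simps)
      also have "\<bar>\<dots>\<bar> \<le> K * (x - t)\<^sup>2 / \<bar>x - t\<bar>"
        using assms[OF x(2)] by (simp add: abs_divide divide_right_mono)
      also have "\<dots> = K * \<bar>x - t\<bar>"
        using x unfolding power2_eq_square abs_mult_self_eq[symmetric, of "x - t"]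
        by (simp del: abs_mult_self_eq)
      also have "\<dots> \<le> \<bar>K\<bar> * \<bar>x - t\<bar>" by (intro mult_right_mono) auto
      finally show "norm ((f x - f t) / (x - t) - D) \<le> \<bar>K\<bar> * \<bar>x - t\<bar>" by simp
    qed
    show "((\<lambda>x. \<bar>K\<bar> * \<bar>x - t\<bar>) \<longlongrightarrow> 0) (at t within T)"
      by (auto intro!: tendsto_eq_intros)
  qed
  then show ?thesis
    unfolding has_field_derivative_iff using LIM_zero_iff by blast
qed

text \<open>Clocks are controlled only over windows to the right of \<open>t\<close>, so
  \<open>step\<close> is one-sided. Boundedness makes \<open>p\<close> Lipschitz, hence also the
  candidate derivative, and an increment to the left costs only another O(h^2). No normalisation of
  \<open>p\<close> is asked for: it will consist of the masses of \<open>A\<close> intersected with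
  \<open>X t = x\<close> for an event \<open>A\<close> of the past.\<close>

lemma forward_equation_unique_quadratic:
  fixes p :: "real \<Rightarrow> 's \<Rightarrow> real"
  assumes S: "finite S" and u: "s \<le> u" and z: "z \<in> S"
    and bound: "\<And>t x. s \<le> t \<Longrightarrow> t \<le> u \<Longrightarrow> x \<in> S \<Longrightarrow> \<bar>p t x\<bar> \<le> 1"
    and step: "\<And>t h y. s \<le> t \<Longrightarrow> 0 \<le> h \<Longrightarrow> t + h \<le> u \<Longrightarrow> y \<in> S \<Longrightarrow>
      \<bar>p (t + h) y - p t y - h * (\<Sum>x\<in>S. p t x * generator S q x y)\<bar> \<le> K * h\<^sup>2"
  shows "p u z = (\<Sum>y\<in>S. p s y * transition_prob S q (u - s) y z)"
proof (rule forward_equation_unique[OF S u z])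
  fix t y assume t: "s \<le> t" "t \<le> u" and y: "y \<in> S"
  let ?A = "generator S q"
  define D where "D = (\<lambda>t y. \<Sum>x\<in>S. p t x * ?A x y)"
  define a where "a = (\<Sum>x\<in>S. \<Sum>y\<in>S. \<bar>?A x y\<bar>)"
  have a0: "a \<ge> 0" unfolding a_def by (intro sum_nonneg) auto
  have a: "(\<Sum>x\<in>S. \<bar>?A x y\<bar>) \<le> a" if "y \<in> S" for y
    unfolding a_def using S that by (intro sum_mono member_le_sum[where f = "\<lambda>y. \<bar>?A _ y\<bar>"]) auto
  have D: "\<bar>D t y\<bar> \<le> a" if "s \<le> t" "t \<le> u" "y \<in> S" for t y
  proof -
    have "\<bar>D t y\<bar> \<le> (\<Sum>x\<in>S. \<bar>p t x * ?A x y\<bar>)" unfolding D_def by simp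
    also have "\<dots> \<le> (\<Sum>x\<in>S. 1 * \<bar>?A x y\<bar>)"
      unfolding abs_mult using bound that by (intro sum_mono mult_right_mono) auto
    finally show ?thesis using a[OF that(3)] by simp
  qed
  \<comment> \<open>By \<open>step\<close> an increment is at most
    \<open>K * h\<^sup>2 + h * a\<close>, and \<open>h \<le> u - s\<close> makes the first term
    linear in \<open>h\<close>.\<close>
  define L where "L = \<bar>K\<bar> * (u - s) + a"
  have lip: "\<bar>p (t + h) x - p t x\<bar> \<le> L * h"
    if "s \<le> t" "0 \<le> h" "t + h \<le> u" "x \<in> S" for t h x
  proof -
    have "\<bar>p (t + h) x - p t x\<bar> \<le> K * h\<^sup>2 + h * \<bar>D t x\<bar>"
    proof -
      have "\<bar>p (t + h) x - p t x - h * D t x\<bar> \<le> K * h\<^sup>2" using step[OF that] by (simp add: D_def)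
      moreover have "\<bar>h * D t x\<bar> = h * \<bar>D t x\<bar>" using that by (simp add: abs_mult)
      ultimately show ?thesis by linarith
    qed
    also have "K * h\<^sup>2 \<le> \<bar>K\<bar> * (u - s) * h"
      unfolding power2_eq_square mult.assoc using that by (intro mult_mono) (auto intro!: mult_right_mono)
    also have "h * \<bar>D t x\<bar> \<le> h * a" using D[of t x] that by (intro mult_left_mono) auto
    finally show ?thesis by (simp add: L_def algebra_simps)
  qed
  have "((\<lambda>t. p t y) has_real_derivative D t y) (at t within {s..u})"
  proof (rule has_real_derivative_quadratic_error[where K = "\<bar>K\<bar> + L * a"])
    fix t' assume t': "t' \<in> {s..u}"
    have L0: "L * a \<ge> 0" using a0 u by (simp add: L_def)
    show "\<bar>p t' y - p t y - (t' - t) * D t y\<bar> \<le> (\<bar>K\<bar> + L * a) * (t' - t)\<^sup>2"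
    proof (cases "t \<le> t'")
      case True
      have "\<bar>p t' y - p t y - (t' - t) * D t y\<bar> \<le> K * (t' - t)\<^sup>2"
        using step[of t "t' - t" y] t t' y True by (simp add: D_def)
      also have "\<dots> \<le> (\<bar>K\<bar> + L * a) * (t' - t)\<^sup>2" using L0 by (intro mult_right_mono) auto
      finally show ?thesis .
    next
      case False
      \<comment> \<open>The increment is read forwards from \<open>t'\<close>, with slope
        \<open>D t' y\<close>; the Lipschitz bound exchanges this slope for \<open>D t y\<close> at
        the cost \<open>L * a * h\<^sup>2\<close>.\<close>
      define h where "h = t - t'"
      have h: "0 \<le> h" "t = t' + h" using False by (auto simp: h_def)
      have "\<bar>D t y - D t' y\<bar> = \<bar>\<Sum>x\<in>S. (p t x - p t' x) * ?A x y\<bar>"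
        by (simp add: D_def sum_subtractf left_diff_distrib)
      also have "\<dots> \<le> (\<Sum>x\<in>S. \<bar>(p t x - p t' x) * ?A x y\<bar>)" by simp
      also have "\<dots> \<le> (\<Sum>x\<in>S. L * h * \<bar>?A x y\<bar>)"
        unfolding abs_mult using lip[of t' h] h t t' by (intro sum_mono mult_right_mono) auto
      also have "\<dots> \<le> L * h * a"
        unfolding sum_distrib_left[symmetric] using a[OF y] h a0 u
        by (intro mult_left_mono) (auto simp: L_def)
      finally have *: "\<bar>D t y - D t' y\<bar> \<le> L * h * a" .
      have "\<bar>p t y - p t' y - h * D t' y\<bar> \<le> \<bar>K\<bar> * h\<^sup>2"
        using step[of t' h y] h t t' y mult_right_mono[OF abs_ge_self[of K], of "h\<^sup>2"]
        by (simp add: D_def)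
      moreover have "\<bar>h * (D t y - D t' y)\<bar> \<le> h * (L * h * a)"
        unfolding abs_mult using * h by (simp add: mult_left_mono)
      moreover have "p t' y - p t y - (t' - t) * D t y =
          - (p t y - p t' y - h * D t' y) + h * (D t y - D t' y)"
        by (simp add: h_def algebra_simps)
      ultimately have "\<bar>p t' y - p t y - (t' - t) * D t y\<bar> \<le> \<bar>K\<bar> * h\<^sup>2 + h * (L * h * a)"
        by linarith
      also have "\<dots> = (\<bar>K\<bar> + L * a) * (t' - t)\<^sup>2"
        by (simp add: h_def power2_eq_square algebra_simps)
      finally show ?thesis .
    qed
  qed
  then show "((\<lambda>t. p t y) has_real_derivative (\<Sum>x\<in>S. p t x * ?A x y)) (at t within {s..u})"
    by (simp add: D_def)
qed

section \<open>Chains driven by independent exponential clocks\<close>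

text \<open>Every element of the type carries a clock, so the sample space consists of all functions
  and one sample drives all graphs over the same vertex type at once.\<close>

definition clock_measure :: "('c \<Rightarrow> real) \<Rightarrow> ('c \<Rightarrow> real) measure" where
  "clock_measure l = (\<Pi>\<^sub>M c\<in>UNIV. density lborel (exponential_density (l c)))"

lemma space_clock_measure [simp]: "space (clock_measure l) = UNIV"
  by (simp add: clock_measure_def space_PiM)

lemma measurable_clock [measurable]: "(\<lambda>w. w c) \<in> borel_measurable (clock_measure l)"
proof -
  have "(\<lambda>w. w c) \<in> clock_measure l \<rightarrow>\<^sub>M density lborel (exponential_density (l c))"
    unfolding clock_measure_def by measurable
  then show ?thesis by simp
qed

text \<open>The window is open at \<open>t\<close> because a ring at exactly \<open>t\<close>
  already shows in the state at time \<open>t\<close>.\<close>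

definition rings :: "'c \<Rightarrow> real \<Rightarrow> real \<Rightarrow> ('c \<Rightarrow> real) set" where
  "rings c t h = {w. t < w c \<and> w c \<le> t + h}"

text \<open>A substitute for measurability with respect to the past: once \<open>c\<close> is known
  to ring after \<open>t\<close>, membership in \<open>A\<close> reveals nothing about when.
  Demanded for every \<open>c\<close>, it expresses that \<open>A\<close> belongs to the history up
  to \<open>t\<close>.\<close>

definition insensitive :: "('c \<Rightarrow> real) set \<Rightarrow> 'c \<Rightarrow> real \<Rightarrow> bool" where
  "insensitive A c t \<longleftrightarrow> (\<forall>w u. t < w c \<and> t < u \<longrightarrow> (w(c := u) \<in> A \<longleftrightarrow> w \<in> A))"

lemma insensitive_Int: "insensitive A c t \<Longrightarrow> insensitive B c t \<Longrightarrow> insensitive (A \<inter> B) c t"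
  by (auto simp: insensitive_def)

lemma insensitive_rings: "c \<noteq> c' \<Longrightarrow> insensitive (rings c' t h) c t"
  by (auto simp: insensitive_def rings_def)

locale exponential_clocks =
  fixes l :: "'c \<Rightarrow> real"
  assumes rate_pos: "l c > 0"
begin

abbreviation "\<Omega> \<equiv> clock_measure l"

sublocale prob_space \<Omega>
  unfolding clock_measure_def by (intro prob_space_PiM prob_space_exponential_density rate_pos)

abbreviation clock_law :: "'c \<Rightarrow> real measure" where
  "clock_law c \<equiv> density lborel (exponential_density (l c))"

lemma rings_sets [measurable]: "rings c t h \<in> sets \<Omega>"
proof -
  have "{w\<in>space \<Omega>. t < w c \<and> w c \<le> t + h} \<in> sets \<Omega>" by measurable
  then show ?thesis by (simp add: rings_def)
qed

lemma clock_law_prob: "prob_space (clock_law c)"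
  by (intro prob_space_exponential_density rate_pos)

text \<open>Overwriting coordinate \<open>c\<close> by an independent draw does not change the
  product measure. On \<open>A\<close> a draw beyond \<open>t\<close> may then be replaced by any
  fixed value beyond \<open>t\<close>, here \<open>t + 1\<close>, which separates the two factors.
  The second factor is the same for all \<open>B\<close>, so ratios for different \<open>B\<close>
  depend on the clock law alone.\<close>

lemma emeasure_clock_split:
  assumes "B \<in> sets borel" and A: "A \<in> sets \<Omega>" and "insensitive A c t" and B: "B \<subseteq> {t<..}"
  shows "emeasure \<Omega> (A \<inter> {w. w c \<in> B}) =
    emeasure (clock_law c) B * emeasure (\<Pi>\<^sub>M i\<in>UNIV. clock_law i) ((\<lambda>w. w(c := t + 1)) -` A)"
proof -
  let ?\<Pi> = "\<Pi>\<^sub>M i\<in>UNIV. clock_law i"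
  interpret C: prob_space "clock_law c" by (rule clock_law_prob)
  interpret Q: prob_space ?\<Pi>
    by (intro prob_space_PiM clock_law_prob)
  have \<Omega>: "\<Omega> = distr (clock_law c \<Otimes>\<^sub>M ?\<Pi>) ?\<Pi> (\<lambda>(x, X). X(c := x))"
    using distr_pair_PiM_eq_PiM[of UNIV clock_law c] clock_law_prob by (simp add: clock_measure_def)
  have AQ [measurable]: "A \<in> sets ?\<Pi>" using A by (simp add: clock_measure_def)
  have f [measurable]: "(\<lambda>(x, X). X(c := x)) \<in> clock_law c \<Otimes>\<^sub>M ?\<Pi> \<rightarrow>\<^sub>M ?\<Pi>"
    using measurable_fun_upd[of UNIV UNIV c "\<lambda>x. snd x" "clock_law c \<Otimes>\<^sub>M ?\<Pi>" clock_law "\<lambda>x. fst x"]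
    by (simp add: case_prod_beta')
  have upd [measurable]: "(\<lambda>X. X(c := u)) \<in> ?\<Pi> \<rightarrow>\<^sub>M ?\<Pi>" for u
    using measurable_fun_upd[of UNIV UNIV c "\<lambda>x. x" ?\<Pi> clock_law "\<lambda>x. u"] by simp
  define A' where "A' = (\<lambda>w. w(c := t + 1)) -` A"
  have A': "A' \<in> sets ?\<Pi>"
    using measurable_sets[OF upd AQ, of "t + 1"] by (simp add: A'_def space_PiM)
  have AB: "A \<inter> {w. w c \<in> B} \<in> sets ?\<Pi>"
  proof -
    have "{w\<in>space \<Omega>. w c \<in> B} \<in> sets \<Omega>" using assms(1) by measurable
    then have "A \<inter> {w\<in>space \<Omega>. w c \<in> B} \<in> sets \<Omega>" using A by blast
    then show ?thesis by (simp add: clock_measure_def space_PiM)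
  qed
  have key: "X(c := x) \<in> A \<longleftrightarrow> X \<in> A'" if "x \<in> B" for x X
  proof -
    have "(X(c := x))(c := t + 1) \<in> A \<longleftrightarrow> X(c := x) \<in> A"
      using assms(3) that B unfolding insensitive_def
      by (metis fun_upd_same greaterThan_iff less_add_one subsetD)
    then show ?thesis by (simp add: A'_def)
  qed
  have "emeasure \<Omega> (A \<inter> {w. w c \<in> B}) = emeasure (clock_law c \<Otimes>\<^sub>M ?\<Pi>) (B \<times> A')"
    unfolding \<Omega> using AB key
    by (subst emeasure_distr) (auto simp: space_pair_measure space_PiM intro!: arg_cong[where f = "emeasure _"])
  also have "\<dots> = emeasure (clock_law c) B * emeasure ?\<Pi> A'"
    using assms(1) A' by (intro Q.emeasure_pair_measure_Times) auto
  finally show ?thesis by (simp add: A'_def)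
qed

lemma clock_law_greater:
  assumes "0 \<le> t" shows "measure (clock_law c) {t<..} = exp (- t * l c)"
proof -
  interpret C: prob_space "clock_law c" by (rule clock_law_prob)
  have "distributed (clock_law c) lborel (\<lambda>x. x) (exponential_density (l c))"
    unfolding distributed_def by (subst distr_id2) (auto simp: exponential_density_nonneg rate_pos)
  from C.exponential_distributedD_gt[OF this assms rate_pos]
  show ?thesis by (simp add: greaterThan_def)
qed

lemma clock_law_interval:
  assumes "0 \<le> t" "0 \<le> h"
  shows "measure (clock_law c) {t<..t+h} = (1 - exp (- h * l c)) * measure (clock_law c) {t<..}"
proof -
  interpret C: prob_space "clock_law c" by (rule clock_law_prob)
  have "{t<..t+h} = {t<..} - {t+h<..}" by auto
  then have "measure (clock_law c) {t<..t+h} = measure (clock_law c) {t<..} - measure (clock_law c) {t+h<..}"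
    using assms by (simp only:) (intro C.finite_measure_Diff, auto)
  then show ?thesis
    using assms by (simp add: clock_law_greater left_diff_distrib exp_add[symmetric] distrib_right)
qed

text \<open>Memorylessness in the presence of a past event: \<open>emeasure_clock_split\<close> is
  applied to \<open>{t<..t+h}\<close> and to \<open>{t<..}\<close>, with a common second factor. The
  right side is confined to \<open>t < w c\<close>, as a clock that has rung does not ring
  again.\<close>

lemma prob_rings:
  assumes A: "A \<in> sets \<Omega>" and ins: "insensitive A c t" and "0 \<le> t" "0 \<le> h"
  shows "prob (A \<inter> rings c t h) = (1 - exp (- h * l c)) * prob (A \<inter> {w. t < w c})"
proof -
  interpret Q: prob_space "\<Pi>\<^sub>M i\<in>UNIV. clock_law i"
    by (intro prob_space_PiM clock_law_prob)
  interpret C: prob_space "clock_law c" by (rule clock_law_prob)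
  have *: "prob (A \<inter> {w. w c \<in> B}) = measure (clock_law c) B *
     measure (\<Pi>\<^sub>M i\<in>UNIV. clock_law i) ((\<lambda>w. w(c := t + 1)) -` A)"
    if "B \<in> sets borel" "B \<subseteq> {t<..}" for B
    using emeasure_clock_split[OF that(1) A ins that(2)] by (simp add: measure_def enn2real_mult)
  show ?thesis
    using *[of "{t<..t+h}"] *[of "{t<..}"] clock_law_interval[OF assms(3,4), of c]
    by (simp add: rings_def greaterThanAtMost_iff subset_iff)
qed

lemma prob_rings_le:
  assumes "A \<in> sets \<Omega>" "insensitive A c t" "0 \<le> t" "0 \<le> h"
  shows "prob (A \<inter> rings c t h) \<le> h * l c * prob A"
proof -
  have "1 - exp (- h * l c) \<le> h * l c"
    using exp_ge_add_one_self[of "- h * l c"] by simp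
  moreover have "prob (A \<inter> {w. t < w c}) \<le> prob A"
    using assms(1) by (intro finite_measure_mono) auto
  ultimately show ?thesis
    unfolding prob_rings[OF assms] using assms(4) rate_pos[of c]
    by (intro mult_mono) (auto simp: mult_nonneg_nonneg less_imp_le)
qed

lemma prob_two_rings:
  assumes "c \<noteq> c'" "0 \<le> t" "0 \<le> h"
  shows "prob (rings c t h \<inter> rings c' t h) \<le> l c * l c' * h\<^sup>2"
proof -
  have "prob (rings c t h \<inter> rings c' t h) \<le> h * l c' * prob (rings c t h)"
    using assms by (intro prob_rings_le insensitive_rings) auto
  moreover have "prob (rings c t h) \<le> h * l c" (is "?a \<le> ?b")
    using prob_rings_le[of UNIV c t h] assms prob_space
    by (simp add: insensitive_def sets.top[of \<Omega>, simplified])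
  then have "h * l c' * ?a \<le> h * l c' * ?b"
    using assms rate_pos[of c'] by (intro mult_left_mono) auto
  ultimately show ?thesis by (simp add: power2_eq_square mult_ac)
qed

lemma AE_clock_pos: "AE w in \<Omega>. 0 < w c"
proof -
  have "AE x in clock_law c. 0 < x"
    using AE_lborel_singleton[of 0]
    by (auto simp: AE_density exponential_density_def elim!: eventually_mono)
  then show ?thesis
    unfolding clock_measure_def by (intro AE_PiM_component clock_law_prob) auto
qed

end

lemma one_minus_exp_bounds:
  fixes x :: real assumes "0 \<le> x"
  shows "\<bar>1 - exp (- x) - x\<bar> \<le> x\<^sup>2"
proof -
  \<comment> \<open>The product equals \<open>1 + x ^ 3\<close>.\<close>
  have "1 \<le> (1 - x + x\<^sup>2) * (1 + x)"
    using assms by (simp add: algebra_simps power2_eq_square)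
  then have "1 / (1 + x) \<le> 1 - x + x\<^sup>2"
    using assms by (simp add: divide_le_eq)
  moreover have "exp (- x) \<le> 1 / (1 + x)"
    unfolding exp_minus inverse_eq_divide using assms exp_ge_add_one_self[of x]
    by (intro divide_left_mono) auto
  moreover have "1 - x \<le> exp (- x)" using exp_ge_add_one_self[of "- x"] by simp
  ultimately show ?thesis by (simp add: abs_le_iff)
qed

text \<open>
  Every clock rings only once, whereas the generator lets the jump \<open>g c\<close> occur at rate \<open>l c\<close> for ever.
  This makes no difference, since by \<open>X_rung\<close> a second jump \<open>g c\<close> would have no effect.
\<close>

locale clock_driven = exponential_clocks l for l :: "'c \<Rightarrow> real" +
  fixes C :: "'c set" and S :: "'s set" and X :: "real \<Rightarrow> ('c \<Rightarrow> real) \<Rightarrow> 's"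
    and g :: "'c \<Rightarrow> 's \<Rightarrow> 's" and x0 :: 's and q :: "'s \<Rightarrow> 's \<Rightarrow> real"
  assumes finite_C: "finite C" and finite_S: "finite S"
    and X_meas: "0 \<le> t \<Longrightarrow> X t \<in> \<Omega> \<rightarrow>\<^sub>M count_space S"
    and X_start: "AE w in \<Omega>. X 0 w = x0"
    and X_adapted: "0 \<le> s \<Longrightarrow> s \<le> t \<Longrightarrow> t < w c \<Longrightarrow> t < u \<Longrightarrow> X s (w(c := u)) = X s w"
    and X_no_ring: "0 \<le> t \<Longrightarrow> 0 \<le> h \<Longrightarrow> (\<And>c. c \<in> C \<Longrightarrow> w \<notin> rings c t h) \<Longrightarrow> X (t + h) w = X t w"
    and X_one_ring: "0 \<le> t \<Longrightarrow> 0 \<le> h \<Longrightarrow> c \<in> C \<Longrightarrow> w \<in> rings c t h \<Longrightarrow>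
      (\<And>c'. c' \<in> C \<Longrightarrow> c' \<noteq> c \<Longrightarrow> w \<notin> rings c' t h) \<Longrightarrow> X (t + h) w = g c (X t w)"
    and X_rung: "0 \<le> t \<Longrightarrow> c \<in> C \<Longrightarrow> w c \<le> t \<Longrightarrow> g c (X t w) = X t w"
    and generator_eq: "x \<in> S \<Longrightarrow> y \<in> S \<Longrightarrow>
      generator S q x y = (\<Sum>c\<in>C. l c * (of_bool (y = g c x) - of_bool (y = x)))"
begin

lemma X_in_S: "0 \<le> t \<Longrightarrow> X t w \<in> S"
  using measurable_space[OF X_meas, of t w] by simp

lemma X_sets: assumes "0 \<le> t" shows "{w. P (X t w)} \<in> sets \<Omega>"
proof -
  have "X t -` {x\<in>S. P x} \<inter> space \<Omega> \<in> sets \<Omega>"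
    using X_meas[OF assms] by (rule measurable_sets) auto
  moreover have "X t -` {x\<in>S. P x} \<inter> space \<Omega> = {w. P (X t w)}"
    using X_in_S[OF assms] by auto
  ultimately show ?thesis by simp
qed

lemma insensitive_X: "0 \<le> s \<Longrightarrow> s \<le> t \<Longrightarrow> insensitive {w. P (X s w)} c t"
  by (auto simp: insensitive_def X_adapted)

lemma prob_event_X:
  assumes A: "A \<in> sets \<Omega>" and "0 \<le> t"
  shows "prob (A \<inter> {w. P (X t w)}) = (\<Sum>x\<in>S. prob (A \<inter> {w. X t w = x}) * of_bool (P x))"
proof -
  have "A \<inter> {w. P (X t w)} = (\<Union>x\<in>{x\<in>S. P x}. A \<inter> {w. X t w = x})"
    using X_in_S[OF assms(2)] by auto
  also have "prob \<dots> = (\<Sum>x\<in>{x\<in>S. P x}. prob (A \<inter> {w. X t w = x}))"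
    using finite_S A X_sets[OF assms(2)]
    by (intro finite_measure_finite_Union) (auto simp: disjoint_family_on_def)
  also have "\<dots> = (\<Sum>x\<in>S. prob (A \<inter> {w. X t w = x}) * of_bool (P x))"
    unfolding sum.inter_filter[OF finite_S] by (intro sum.cong) auto
  finally show ?thesis .
qed

text \<open>With at most one ring the first-order formula is exact. With more, the crude bound
  \<open>1 + card C\<close> is paid for by the double sum, which counts ordered pairs of distinct
  ringing clocks and is then at least 1.\<close>

lemma step_pointwise:
  fixes y :: 's
  assumes "0 \<le> t" "0 \<le> h"
  defines "f \<equiv> (\<lambda>x. of_bool (x = y) :: real)"
  shows "\<bar>f (X (t + h) w) - f (X t w) - (\<Sum>c\<in>C. of_bool (w \<in> rings c t h) * (f (g c (X t w)) - f (X t w)))\<bar>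
    \<le> (1 + real (card C)) * (\<Sum>c\<in>C. \<Sum>c'\<in>C - {c}. of_bool (w \<in> rings c t h \<inter> rings c' t h) :: real)"
  (is "\<bar>?D\<bar> \<le> _ * ?E")
proof -
  have E0: "0 \<le> ?E" by (intro sum_nonneg) auto
  consider "\<And>c. c \<in> C \<Longrightarrow> w \<notin> rings c t h"
    | c where "c \<in> C" "w \<in> rings c t h" "\<And>c'. c' \<in> C \<Longrightarrow> c' \<noteq> c \<Longrightarrow> w \<notin> rings c' t h"
    | c c' where "c \<in> C" "c' \<in> C" "c' \<noteq> c" "w \<in> rings c t h" "w \<in> rings c' t h"
    by blast
  then show ?thesis
  proof cases
    case 1
    then have "?D = 0" using X_no_ring[of t h w] assms by simp
    then show ?thesis using E0 by simp
  next
    case 2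
    have "(\<Sum>c\<in>C. of_bool (w \<in> rings c t h) * (f (g c (X t w)) - f (X t w))) =
        (\<Sum>c'\<in>{c}. of_bool (w \<in> rings c t h) * (f (g c (X t w)) - f (X t w)))"
      using finite_C 2 by (intro sum.mono_neutral_cong_right) auto
    then have "?D = 0" using X_one_ring[of t h c w] assms 2 by simp
    then show ?thesis using E0 by simp
  next
    case 3
    have "(1::real) \<le> (\<Sum>c'\<in>C - {c}. of_bool (w \<in> rings c t h \<inter> rings c' t h) :: real)"
      using member_le_sum[of c' "C - {c}" "\<lambda>c'. of_bool (w \<in> rings c t h \<inter> rings c' t h) :: real"] finite_C 3
      by simp
    also have "\<dots> \<le> ?E"
      using finite_C 3 by (intro member_le_sum[where f = "\<lambda>c. \<Sum>c'\<in>C - {c}. of_bool (w \<in> rings c t h \<inter> rings c' t h)"])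
        (auto intro!: sum_nonneg)
    finally have E: "1 \<le> ?E" .
    have "\<bar>\<Sum>c\<in>C. of_bool (w \<in> rings c t h) * (f (g c (X t w)) - f (X t w))\<bar> \<le> (\<Sum>c\<in>C. 1)"
      by (intro order_trans[OF sum_abs] sum_mono) (auto simp: f_def)
    moreover have "\<bar>f (X (t + h) w) - f (X t w)\<bar> \<le> 1" by (auto simp: f_def)
    ultimately have "\<bar>?D\<bar> \<le> 1 + card C" by simp
    also have "\<dots> \<le> (1 + real (card C)) * ?E" using mult_left_mono[OF E, of "1 + real (card C)"] by simp
    finally show ?thesis .
  qed
qed

text \<open>The first term pays for windows with two rings, the second for replacing
  \<open>1 - exp (- h * l c)\<close> by \<open>h * l c\<close>.\<close>

definition step_const :: real where
  "step_const = (1 + real (card C)) * (\<Sum>c\<in>C. \<Sum>c'\<in>C - {c}. l c * l c') + (\<Sum>c\<in>C. (l c)\<^sup>2)"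

text \<open>Two clocks ring within time \<open>h\<close> with probability \<open>O(h\<^sup>2)\<close> only, so single rings give the generator.\<close>

lemma prob_step:
  assumes A: "A \<in> sets \<Omega>" and ins: "\<And>c. insensitive A c t" and t: "0 \<le> t" and h: "0 \<le> h" and y: "y \<in> S"
  shows "\<bar>prob (A \<inter> {w. X (t + h) w = y}) - prob (A \<inter> {w. X t w = y})
    - h * (\<Sum>x\<in>S. prob (A \<inter> {w. X t w = x}) * generator S q x y)\<bar> \<le> step_const * h\<^sup>2"
proof -
  define R where "R c = rings c t h" for c :: 'c
  define Y where "Y = {w. X t w = y}"
  define G where "G c = {w. g c (X t w) = y}" for c
  define Z where "Z = {w. X (t + h) w = y}"
  have [measurable]: "A \<in> sets \<Omega>" "R c \<in> sets \<Omega>" "Y \<in> sets \<Omega>" "G c \<in> sets \<Omega>" "Z \<in> sets \<Omega>" for c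
    using A t h X_sets[of t "\<lambda>x. x = y"] X_sets[of "t + h" "\<lambda>x. x = y"] X_sets[of t "\<lambda>x. g c x = y"]
    by (auto simp: R_def Y_def G_def Z_def)
  have int: "integrable \<Omega> (indicator B :: _ \<Rightarrow> real)" if "B \<in> sets \<Omega>" for B
    using that by (simp add: emeasure_eq_measure)
  define \<delta> where "\<delta> c = prob (A \<inter> G c) - prob (A \<inter> Y)" for c
  have ring_diff: "prob (A \<inter> G c \<inter> R c) - prob (A \<inter> Y \<inter> R c) = (1 - exp (- h * l c)) * \<delta> c" if c: "c \<in> C" for c
  proof -
    let ?L = "{w. t < w c}" and ?M = "{w. w c \<le> t}"
    have [measurable]: "?L \<in> sets \<Omega>" "?M \<in> sets \<Omega>"
    proof -
      have "{w\<in>space \<Omega>. t < w c} \<in> sets \<Omega>" "{w\<in>space \<Omega>. w c \<le> t} \<in> sets \<Omega>" by measurable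
      then show "?L \<in> sets \<Omega>" "?M \<in> sets \<Omega>" by simp_all
    qed
    have ring: "prob (A \<inter> B \<inter> R c) = (1 - exp (- h * l c)) * prob (A \<inter> B \<inter> ?L)"
      if "B = {w. P (X t w)}" for B P
      unfolding R_def using that A ins t h X_sets[of t P]
      by (intro prob_rings insensitive_Int) (auto simp: insensitive_X)
    have split: "prob B = prob (B \<inter> ?L) + prob (B \<inter> ?M)" if "B \<in> sets \<Omega>" for B
    proof -
      have "B = (B \<inter> ?L) \<union> (B \<inter> ?M)" by auto
      then show ?thesis
        using that by (subst finite_measure_Union[symmetric]) auto
    qed
    have "A \<inter> G c \<inter> ?M = A \<inter> Y \<inter> ?M" using X_rung[OF t c] by (auto simp: G_def Y_def)
    then have "prob (A \<inter> G c \<inter> ?L) - prob (A \<inter> Y \<inter> ?L) = \<delta> c"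
      using split[of "A \<inter> G c"] split[of "A \<inter> Y"] by (simp add: \<delta>_def)
    then show ?thesis
      using ring[OF G_def[of c]] ring[OF Y_def] by (simp add: right_diff_distrib[symmetric])
  qed
  define D :: "('c \<Rightarrow> real) \<Rightarrow> real" where
    "D w = indicator (A \<inter> Z) w - indicator (A \<inter> Y) w - (\<Sum>c\<in>C. indicator (A \<inter> G c \<inter> R c) w - indicator (A \<inter> Y \<inter> R c) w)" for w
  define E :: "('c \<Rightarrow> real) \<Rightarrow> real" where
    "E w = (1 + real (card C)) * (\<Sum>c\<in>C. \<Sum>c'\<in>C - {c}. indicator (R c \<inter> R c') w :: real)" for w
  have "\<bar>D w\<bar> \<le> E w" for w
  proof (cases "w \<in> A")
    case True
    have "D w = of_bool (X (t + h) w = y) - of_bool (X t w = y) -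
        (\<Sum>c\<in>C. of_bool (w \<in> rings c t h) * (of_bool (g c (X t w) = y) - of_bool (X t w = y)))"
      unfolding D_def
      by (intro arg_cong2[where f = "(-)"] sum.cong) (use True in \<open>auto simp: R_def Y_def G_def Z_def\<close>)
    moreover have "E w = (1 + real (card C)) * (\<Sum>c\<in>C. \<Sum>c'\<in>C - {c}. of_bool (w \<in> rings c t h \<inter> rings c' t h) :: real)"
      unfolding E_def by (simp add: indicator_def R_def)
    ultimately show ?thesis using step_pointwise[OF t h, of w y] by simp
  next
    case False
    then show ?thesis by (auto simp: D_def E_def intro!: sum_nonneg mult_nonneg_nonneg)
  qed
  moreover have intD: "integrable \<Omega> D" and intE: "integrable \<Omega> E"
    unfolding D_def E_def by (intro Bochner_Integration.integrable_diff Bochner_Integration.integrable_sum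
        integrable_mult_right int; measurable)+
  ultimately have "\<bar>expectation D\<bar> \<le> expectation E"
    using integral_mono[OF integrable_abs[OF intD] intE]
    by (intro order_trans[OF integral_abs_bound]) simp
  moreover have "expectation D = prob (A \<inter> Z) - prob (A \<inter> Y) - (\<Sum>c\<in>C. prob (A \<inter> G c \<inter> R c) - prob (A \<inter> Y \<inter> R c))"
    unfolding D_def by (simp add: int integral_diff integral_sum)
  moreover have "expectation E = (1 + real (card C)) * (\<Sum>c\<in>C. \<Sum>c'\<in>C - {c}. prob (R c \<inter> R c'))"
    unfolding E_def by (simp add: int integral_sum)
  moreover have "\<dots> \<le> (1 + real (card C)) * (\<Sum>c\<in>C. \<Sum>c'\<in>C - {c}. l c * l c' * h\<^sup>2)"
    unfolding R_def using t h by (intro mult_left_mono sum_mono prob_two_rings) auto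
  moreover have "\<dots> = (1 + real (card C)) * (\<Sum>c\<in>C. \<Sum>c'\<in>C - {c}. l c * l c') * h\<^sup>2"
    by (simp add: sum_distrib_right mult.assoc)
  moreover have "(\<Sum>c\<in>C. prob (A \<inter> G c \<inter> R c) - prob (A \<inter> Y \<inter> R c)) = (\<Sum>c\<in>C. (1 - exp (- h * l c)) * \<delta> c)"
    by (intro sum.cong refl ring_diff)
  ultimately have 1: "\<bar>prob (A \<inter> Z) - prob (A \<inter> Y) - (\<Sum>c\<in>C. (1 - exp (- h * l c)) * \<delta> c)\<bar>
      \<le> (1 + real (card C)) * (\<Sum>c\<in>C. \<Sum>c'\<in>C - {c}. l c * l c') * h\<^sup>2"
    by linarith
  have "\<bar>\<delta> c\<bar> \<le> 1" for c
    unfolding \<delta>_def abs_le_iff using measure_nonneg[of \<Omega>] prob_le_1 by (smt (verit))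
  then have "\<bar>(1 - exp (- h * l c)) * \<delta> c - h * (l c * \<delta> c)\<bar> \<le> (l c)\<^sup>2 * h\<^sup>2" for c
  proof -
    have "\<bar>(1 - exp (- h * l c)) * \<delta> c - h * (l c * \<delta> c)\<bar> = \<bar>1 - exp (- (h * l c)) - h * l c\<bar> * \<bar>\<delta> c\<bar>"
      by (simp add: abs_mult[symmetric] algebra_simps)
    also have "\<dots> \<le> (h * l c)\<^sup>2 * 1"
      using h rate_pos[of c] \<open>\<bar>\<delta> c\<bar> \<le> 1\<close> by (intro mult_mono one_minus_exp_bounds) auto
    finally show ?thesis by (simp add: power_mult_distrib mult.commute)
  qed
  then have 2: "\<bar>(\<Sum>c\<in>C. (1 - exp (- h * l c)) * \<delta> c) - h * (\<Sum>c\<in>C. l c * \<delta> c)\<bar> \<le> (\<Sum>c\<in>C. (l c)\<^sup>2) * h\<^sup>2"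
    unfolding sum_distrib_left sum_subtractf[symmetric] sum_distrib_right
    by (intro order_trans[OF sum_abs] sum_mono)
  have 3: "(\<Sum>c\<in>C. l c * \<delta> c) = (\<Sum>x\<in>S. prob (A \<inter> {w. X t w = x}) * generator S q x y)"
  proof -
    have "\<delta> c = (\<Sum>x\<in>S. prob (A \<inter> {w. X t w = x}) * (of_bool (y = g c x) - of_bool (y = x)))" for c
      unfolding \<delta>_def G_def Y_def prob_event_X[OF A t, of "\<lambda>x. g c x = y"] prob_event_X[OF A t, of "\<lambda>x. x = y"]
      by (simp add: sum_subtractf[symmetric] right_diff_distrib eq_commute)
    then show ?thesis
      using y by (simp add: generator_eq sum_distrib_left mult_ac) (rule sum.swap)
  qed
  show ?thesis
    using 1 2 unfolding 3[symmetric] step_const_def Y_def Z_def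
      distrib_right[of "(1 + real (card C)) * (\<Sum>c\<in>C. \<Sum>c'\<in>C - {c}. l c * l c')"]
    by linarith
qed

text \<open>An event that is insensitive at \<open>s\<close> stays so at all later times, so
  \<open>A\<close> can be kept fixed while the masses of \<open>A\<close> intersected with
  \<open>X t = x\<close> evolve from \<open>s\<close> to \<open>u\<close>. This is the Markov
  property without conditional expectations.\<close>

lemma prob_markov:
  assumes A: "A \<in> sets \<Omega>" and ins: "\<And>c. insensitive A c s" and s: "0 \<le> s" "s \<le> u" and z: "z \<in> S"
  shows "prob (A \<inter> {w. X u w = z}) =
    (\<Sum>y\<in>S. prob (A \<inter> {w. X s w = y}) * transition_prob S q (u - s) y z)"
proof (rule forward_equation_unique_quadratic[OF finite_S s(2) z, where K = step_const])
  fix t h y assume *: "s \<le> t" "0 \<le> h" "t + h \<le> u" "y \<in> S"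
  have "insensitive A c t" for c
    using ins[of c] *(1) unfolding insensitive_def by fastforce
  then show "\<bar>prob (A \<inter> {w. X (t + h) w = y}) - prob (A \<inter> {w. X t w = y}) -
      h * (\<Sum>x\<in>S. prob (A \<inter> {w. X t w = x}) * generator S q x y)\<bar> \<le> step_const * h\<^sup>2"
    using * s A by (intro prob_step) auto
qed simp

text \<open>Induction on the number of times: the values prescribed so far form the event
  \<open>A\<close> of \<open>prob_markov\<close>, with \<open>s = t k\<close>. The base case takes
  \<open>A = UNIV\<close> and \<open>s = 0\<close>.\<close>

theorem fdd:
  fixes t :: "nat \<Rightarrow> real"
  assumes t0: "0 \<le> t 0" and mono: "\<And>i. i < k \<Longrightarrow> t i \<le> t (Suc i)" and x: "\<And>i. i \<le> k \<Longrightarrow> x i \<in> S"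
    and x0: "x0 \<in> S"
  shows "prob {w. \<forall>i\<le>k. X (t i) w = x i} =
    transition_prob S q (t 0) x0 (x 0) * (\<Prod>i<k. transition_prob S q (t (Suc i) - t i) (x i) (x (Suc i)))"
  using mono x
proof (induction k)
  case 0
  have "prob (UNIV \<inter> {w. X 0 w = y}) = of_bool (y = x0)" for y
  proof (cases "y = x0")
    case True
    then show ?thesis using X_start X_sets[of 0 "\<lambda>x. x = x0"] by (simp add: prob_eq_1)
  next
    case False
    then have "AE w in \<Omega>. X 0 w \<noteq> y" using X_start by auto
    then show ?thesis using X_sets[of 0 "\<lambda>x. x = y"] False by (simp add: prob_eq_0)
  qed
  then have "prob (UNIV \<inter> {w. X (t 0) w = x 0}) = (\<Sum>y\<in>S. of_bool (y = x0) * transition_prob S q (t 0 - 0) y (x 0))"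
    using 0 t0 prob_markov[of UNIV 0 "t 0" "x 0"] sets.top[of \<Omega>] by (simp add: insensitive_def)
  then show ?case
    using finite_S x0 by (simp add: of_bool_def if_distrib if_distribR cong: if_cong)
next
  case (Suc k)
  define A where "A = {w. \<forall>i\<le>k. X (t i) w = x i}"
  have tk: "t i \<le> t j" if "i \<le> j" "j \<le> Suc k" for i j
    using that(1,2)
  proof (induction j rule: dec_induct)
    case (step n)
    then show ?case using Suc.prems(1)[of n] by simp
  qed simp
  have t_nonneg: "0 \<le> t i" if "i \<le> Suc k" for i using tk[of 0 i] t0 that by simp
  have A_eq: "A = (\<Inter>i\<in>{..k}. {w. X (t i) w = x i})" by (auto simp: A_def)
  have A: "A \<in> sets \<Omega>"
    unfolding A_eq using t_nonneg by (intro sets.finite_INT X_sets) auto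
  have ins: "insensitive A c (t k)" for c
    using X_adapted[of _ "t k"] tk t_nonneg by (auto simp: A_def insensitive_def)
  have "{w. \<forall>i\<le>Suc k. X (t i) w = x i} = A \<inter> {w. X (t (Suc k)) w = x (Suc k)}"
    by (auto simp: A_def le_Suc_eq)
  then have "prob {w. \<forall>i\<le>Suc k. X (t i) w = x i} =
      (\<Sum>y\<in>S. prob (A \<inter> {w. X (t k) w = y}) * transition_prob S q (t (Suc k) - t k) y (x (Suc k)))"
    using A ins Suc.prems t_nonneg by (simp add: prob_markov)
  also have "\<dots> = (\<Sum>y\<in>{x k}. prob (A \<inter> {w. X (t k) w = y}) * transition_prob S q (t (Suc k) - t k) y (x (Suc k)))"
  proof (intro sum.mono_neutral_right ballI finite_S)
    fix y assume "y \<in> S - {x k}"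
    then have "A \<inter> {w. X (t k) w = y} = {}" by (auto simp: A_def)
    then show "prob (A \<inter> {w. X (t k) w = y}) * transition_prob S q (t (Suc k) - t k) y (x (Suc k)) = 0" by simp
  qed (use Suc.prems in auto)
  also have "A \<inter> {w. X (t k) w = x k} = A" by (auto simp: A_def)
  ultimately show ?case
    using Suc by (simp add: A_def mult.assoc)
qed

end

section \<open>Rooted trees\<close>

lemma rtranclp_distinct_path:
  assumes "R\<^sup>*\<^sup>* x y"
  obtains xs where "xs \<noteq> []" "hd xs = x" "last xs = y" "distinct xs" "successively R xs"
proof -
  from assms have "\<exists>xs. xs \<noteq> [] \<and> hd xs = x \<and> last xs = y \<and> distinct xs \<and> successively R xs"
  proof (induction rule: rtranclp_induct)
    case base
    show ?case by (rule exI[of _ "[x]"]) simp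
  next
    case (step y z)
    then obtain xs where xs: "xs \<noteq> []" "hd xs = x" "last xs = y" "distinct xs" "successively R xs"
      by blast
    show ?case
    proof (cases "z \<in> set xs")
      case True
      then obtain ys zs where split: "xs = ys @ z # zs" by (meson split_list)
      show ?thesis
        by (rule exI[of _ "ys @ [z]"])
          (use xs split in \<open>auto simp: successively_append_iff hd_append split: if_splits\<close>)
    next
      case False
      show ?thesis
        by (rule exI[of _ "xs @ [z]"])
          (use xs False step in \<open>auto simp: successively_append_iff\<close>)
    qed
  qed
  then show ?thesis using that by blast
qed

text \<open>A simple path from \<open>u\<close> to \<open>w\<close> that avoids the edge between
  them closes up to a cycle. Deleting this edge rules out the path with only two vertices, so at
  least three remain.\<close>

lemma edge_on_cycle:
  assumes uw: "{u, w} \<in> edges G" "u \<noteq> w"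
    and conn: "(adj (G\<lparr>edges := edges G - {{u, w}}\<rparr>))\<^sup>*\<^sup>* u w"
  shows "\<exists>xs. cycle G xs"
proof -
  let ?G' = "G\<lparr>edges := edges G - {{u, w}}\<rparr>"
  obtain xs where xs: "xs \<noteq> []" "hd xs = u" "last xs = w" "distinct xs" "successively (adj ?G') xs"
    using rtranclp_distinct_path[OF conn] by blast
  have nth: "adj ?G' (xs ! i) (xs ! Suc i)" if "Suc i < length xs" for i
    using xs(5) that by (simp add: successively_conv_nth)
  have "length xs \<noteq> 1" using xs uw by (cases xs) auto
  moreover have "length xs \<noteq> 2"
  proof
    assume "length xs = 2"
    then have "xs = [u, w]" using xs by (cases xs; cases "tl xs") auto
    then show False using xs(5) by (simp add: adj_def)
  qed
  moreover have "length xs \<noteq> 0" using xs(1) by simp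
  ultimately have len: "3 \<le> length xs" by linarith
  have "adj G (xs ! i) (xs ! (Suc i mod length xs))" if "i < length xs" for i
  proof (cases "Suc i < length xs")
    case True
    then show ?thesis using nth[OF True] by (simp add: adj_def)
  next
    case False
    then have "Suc i = length xs" using that by simp
    then have "xs ! i = w" "xs ! 0 = u"
      using xs last_conv_nth[of xs] hd_conv_nth[of xs] by (metis diff_Suc_1)+
    then show ?thesis
      using uw \<open>Suc i = length xs\<close> by (simp add: adj_def insert_commute)
  qed
  then show ?thesis using len xs by (auto simp: cycle_def)
qed

text \<open>The parent map and the depth are parameters rather than derived from the graph, so that
  a tree and its connected subgraphs through \<open>r\<close> share them, and with them the same
  freezing times. The depth makes climbing to the root terminate.\<close>

locale rooted_tree =
  fixes T :: "'a ugraph" and r :: 'a and p :: "'a \<Rightarrow> 'a" and d :: "'a \<Rightarrow> nat"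
  assumes root_in: "r \<in> verts T" and depth_root: "d r = 0"
    and parent_in: "v \<in> verts T \<Longrightarrow> v \<noteq> r \<Longrightarrow> p v \<in> verts T"
    and depth_parent: "v \<in> verts T \<Longrightarrow> v \<noteq> r \<Longrightarrow> d v = Suc (d (p v))"
    and edges_eq: "edges T = {{v, p v} |v. v \<in> verts T \<and> v \<noteq> r}"

text \<open>\<open>d\<close> is the distance from \<open>r\<close>, and \<open>p\<close> chooses a
  neighbour one step closer. An edge that joins no vertex to its parent could be deleted without
  disconnecting any vertex from \<open>r\<close>, as all the parent edges survive; so it would lie
  on a cycle.\<close>

lemma tree_rooted:
  assumes T: "tree T" and r: "r \<in> verts T"
  obtains p d where "rooted_tree T r p d"
proof -
  have simple: "simple_graph T" and conn: "connected_graph T" and acyc: "\<nexists>xs. cycle T xs"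
    using T by (auto simp: tree_def)
  define d where "d v = (LEAST n. (adj T ^^ n) r v)" for v
  have d: "(adj T ^^ d v) r v" if "v \<in> verts T" for v
  proof -
    have "(adj T)\<^sup>*\<^sup>* r v" using conn r that by (auto simp: connected_graph_def)
    then obtain n where "(adj T ^^ n) r v" by (auto simp: rtranclp_power)
    then show ?thesis unfolding d_def by (rule LeastI)
  qed
  have d_le: "d v \<le> n" if "(adj T ^^ n) r v" for n v
    unfolding d_def using that by (rule Least_le)
  have in_verts: "u \<in> verts T" "v \<in> verts T" if "adj T u v" for u v
    using simple that by (auto simp: simple_graph_def adj_def)
  have "\<exists>u. adj T u v \<and> d v = Suc (d u)" if v: "v \<in> verts T" "v \<noteq> r" for v
  proof (cases "d v")
    case 0
    then show ?thesis using d[OF v(1)] v(2) by simp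
  next
    case (Suc m)
    then obtain u where u: "(adj T ^^ m) r u" "adj T u v"
      using d[OF v(1)] by auto
    have "Suc m \<le> Suc (d u)"
      unfolding Suc[symmetric] using d[OF in_verts(1)[OF u(2)]] u(2) by (intro d_le) auto
    then show ?thesis using u d_le[OF u(1)] Suc by (intro exI[of _ u]) auto
  qed
  then have "\<exists>p. \<forall>v\<in>verts T - {r}. adj T (p v) v \<and> d v = Suc (d (p v))"
    by (intro bchoice) auto
  then obtain p where p: "\<And>v. v \<in> verts T \<Longrightarrow> v \<noteq> r \<Longrightarrow> adj T (p v) v \<and> d v = Suc (d (p v))"
    by blast
  have "e \<in> {{v, p v} |v. v \<in> verts T \<and> v \<noteq> r}" if e: "e \<in> edges T" for e
  proof (rule ccontr)
    assume not: "e \<notin> {{v, p v} |v. v \<in> verts T \<and> v \<noteq> r}"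
    obtain u w where uw: "e = {u, w}" "u \<noteq> w"
      using simple e by (auto simp: simple_graph_def card_2_iff)
    then have "u \<in> verts T" "w \<in> verts T" using simple e by (auto simp: simple_graph_def)
    let ?G' = "T\<lparr>edges := edges T - {{u, w}}\<rparr>"
    have sym: "symp (adj ?G')" by (auto simp: symp_def adj_def insert_commute)
    have reach: "(adj ?G')\<^sup>*\<^sup>* v r" if "v \<in> verts T" for v
      using that
    proof (induction "d v" arbitrary: v rule: less_induct)
      case less
      show ?case
      proof (cases "v = r")
        case False
        have pv: "adj T (p v) v" "d (p v) < d v" using p[OF less.prems False] by auto
        have "{v, p v} \<noteq> e" using not less.prems False by blast
        then have "adj ?G' v (p v)" using pv uw by (auto simp: adj_def insert_commute)
        moreover have "(adj ?G')\<^sup>*\<^sup>* (p v) r" using less.hyps[OF pv(2) in_verts(1)[OF pv(1)]] .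
        ultimately show ?thesis by (rule converse_rtranclp_into_rtranclp)
      qed simp
    qed
    have "(adj ?G')\<^sup>*\<^sup>* u w"
      using reach[OF \<open>u \<in> verts T\<close>] reach[OF \<open>w \<in> verts T\<close>] sympD[OF symp_rtranclp[OF sym]]
      by (meson rtranclp_trans)
    then show False using edge_on_cycle[of u w T] e uw acyc by blast
  qed
  moreover have "{v, p v} \<in> edges T" if "v \<in> verts T" "v \<noteq> r" for v
    using p[OF that] by (simp add: adj_def insert_commute)
  ultimately have "edges T = {{v, p v} |v. v \<in> verts T \<and> v \<noteq> r}" by blast
  moreover have "d r = 0" using d_le[of 0 r] by simp
  ultimately have "rooted_tree T r p d"
  proof (intro rooted_tree.intro)
    fix v assume "v \<in> verts T" "v \<noteq> r"
    with p have "adj T (p v) v \<and> d v = Suc (d (p v))" by blast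
    then show "p v \<in> verts T" "d v = Suc (d (p v))" using in_verts(1)[of "p v" v] by simp_all
  qed (rule r)
  then show ?thesis using that by blast
qed

context rooted_tree
begin

lemma parent_neq: "v \<in> verts T \<Longrightarrow> v \<noteq> r \<Longrightarrow> p v \<noteq> v"
  using depth_parent[of v] by auto

lemma parent_edge: "v \<in> verts T \<Longrightarrow> v \<noteq> r \<Longrightarrow> {v, p v} \<in> edges T"
  by (auto simp: edges_eq)

lemma edge_subset: "e \<in> edges T \<Longrightarrow> e \<subseteq> verts T"
  by (auto simp: edges_eq parent_in)

lemma card_edge: "e \<in> edges T \<Longrightarrow> card e = 2"
proof -
  assume "e \<in> edges T"
  then obtain v where "v \<in> verts T" "v \<noteq> r" "e = {v, p v}" by (auto simp: edges_eq)
  then show ?thesis using parent_neq[of v] by simp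
qed

lemma simple: "simple_graph T"
  by (simp add: simple_graph_def edge_subset card_edge)

lemma finite_edges: "finite (verts T) \<Longrightarrow> finite (edges T)"
  using edge_subset by (intro finite_subset[of "edges T" "Pow (verts T)"]) auto

lemma depth_induct [consumes 1, case_names root parent]:
  assumes "v \<in> verts T" and "P r"
    and "\<And>v. v \<in> verts T \<Longrightarrow> v \<noteq> r \<Longrightarrow> p v \<in> verts T \<Longrightarrow> P (p v) \<Longrightarrow> P v"
  shows "P v"
  using assms(1)
proof (induction "d v" arbitrary: v rule: less_induct)
  case less
  show ?case
  proof (cases "v = r")
    case False
    then show ?thesis using less parent_in[of v] depth_parent[of v] assms(3)[of v] by simp
  qed (use assms(2) in simp)
qed

definition climbs :: "'a \<Rightarrow> 'a \<Rightarrow> bool" where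
  "climbs v u \<longleftrightarrow> v \<in> verts T \<and> v \<noteq> r \<and> u = p v"

lemma climbs_depth: "climbs\<^sup>*\<^sup>* v u \<Longrightarrow> v = u \<or> d u < d v"
proof (induction rule: rtranclp_induct)
  case (step a b)
  then show ?case using depth_parent[of a] by (auto simp: climbs_def)
qed simp

text \<open>A walk can leave the descendants of \<open>v\<close> only by stepping up from
  \<open>v\<close> itself, and this edge is missing. Used for subgraphs of the tree and for the
  graph of open edges.\<close>

lemma reach_climbs:
  assumes G: "edges G \<subseteq> edges T" and v: "v = r \<or> {v, p v} \<notin> edges G" and "(adj G)\<^sup>*\<^sup>* v u"
  shows "climbs\<^sup>*\<^sup>* u v"
  using assms(3)
proof (induction rule: rtranclp_induct)
  case (step a b)
  have "{a, b} \<in> edges T" using step G by (auto simp: adj_def)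
  then obtain c where c: "{a, b} = {c, p c}" "climbs c (p c)"
    by (auto simp: edges_eq climbs_def)
  show ?case
  proof (cases "b = c")
    case True
    then have "a = p c" using c(1) by (auto simp: doubleton_eq_iff)
    then show ?thesis using step.IH c(2) True by (metis converse_rtranclp_into_rtranclp)
  next
    case False
    then have ab: "a = c" "b = p c" using c(1) by (auto simp: doubleton_eq_iff)
    have "a \<noteq> v" using step.hyps c(2) v ab by (auto simp: adj_def climbs_def)
    then show ?thesis
      using step.IH ab by (metis climbs_def converse_rtranclpE)
  qed
qed simp

text \<open>If the edge above \<open>v\<close> were missing, the walk in \<open>H\<close> from
  \<open>v\<close> to \<open>r\<close> would stay below \<open>v\<close>, and \<open>r\<close> would
  have positive depth. So parents in \<open>H\<close> are the parents in the large tree.\<close>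

lemma connected_subgraph_rooted:
  assumes H: "subgraph H T" "connected_graph H" "r \<in> verts H"
  shows "rooted_tree H r p d"
proof -
  have sub: "verts H \<subseteq> verts T" "edges H \<subseteq> edges T" and simple: "simple_graph H"
    using H by (auto simp: subgraph_def)
  have e: "{v, p v} \<in> edges H" if v: "v \<in> verts H" "v \<noteq> r" for v
  proof (rule ccontr)
    assume "{v, p v} \<notin> edges H"
    moreover have "(adj H)\<^sup>*\<^sup>* v r" using H v by (auto simp: connected_graph_def)
    ultimately have "climbs\<^sup>*\<^sup>* r v" using reach_climbs[OF sub(2)] by blast
    then show False using v climbs_depth[of r v] depth_root by simp
  qed
  have pv: "p v \<in> verts H" if "v \<in> verts H" "v \<noteq> r" for v
    using e[OF that] simple by (auto simp: simple_graph_def)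
  show ?thesis
  proof
    show "edges H = {{v, p v} |v. v \<in> verts H \<and> v \<noteq> r}"
    proof (intro equalityI subsetI)
      fix x assume x: "x \<in> edges H"
      then obtain v where "x = {v, p v}" "v \<noteq> r" using sub(2) by (auto simp: edges_eq)
      moreover have "x \<subseteq> verts H" using x simple by (simp add: simple_graph_def)
      ultimately show "x \<in> {{v, p v} |v. v \<in> verts H \<and> v \<noteq> r}" by blast
    next
      fix x assume "x \<in> {{v, p v} |v. v \<in> verts H \<and> v \<noteq> r}"
      then obtain v where "x = {v, p v}" "v \<in> verts H" "v \<noteq> r" by blast
      then show "x \<in> edges H" using e[of v] by simp
    qed
    show "r \<in> verts H" by (rule H)
    show "d r = 0" by (rule depth_root)
    fix v assume v: "v \<in> verts H" "v \<noteq> r"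
    show "p v \<in> verts H" using pv[OF v] .
    show "d v = Suc (d (p v))" using depth_parent[OF subsetD[OF sub(1) v(1)] v(2)] .
  qed
qed

lemma connected: "connected_graph T"
proof -
  have sym: "symp (adj T)" by (auto simp: symp_def adj_def insert_commute)
  have reach: "(adj T)\<^sup>*\<^sup>* v r" if "v \<in> verts T" for v
    using that
  proof (induction v rule: depth_induct)
    case (parent v)
    have "adj T v (p v)" using parent_edge[OF parent(1,2)] by (simp add: adj_def)
    then show ?case using parent.IH by (rule converse_rtranclp_into_rtranclp)
  qed simp
  have "(adj T)\<^sup>*\<^sup>* u v" if "u \<in> verts T" "v \<in> verts T" for u v
    using rtranclp_trans[OF reach[OF that(1)] sympD[OF symp_rtranclp[OF sym] reach[OF that(2)]]] .
  then show ?thesis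
    using root_in by (auto simp: connected_graph_def)
qed

end

section \<open>Percolation with constant freezing on rooted trees\<close>

text \<open>\<open>v\<close> heads its cluster until the edge to its parent opens. That happens if
  the edge rings before the parent freezes and before \<open>w {v}\<close>, and then the freezing
  time of the parent is inherited. The number counts the levels up to the root;
  \<open>freeze_time\<close> passes \<open>d v\<close>, which makes the recursion primitive.\<close>

primrec freeze_time_upto :: "('a \<Rightarrow> 'a) \<Rightarrow> ('a set \<Rightarrow> real) \<Rightarrow> nat \<Rightarrow> 'a \<Rightarrow> real" where
  "freeze_time_upto p w 0 v = w {v}"
| "freeze_time_upto p w (Suc n) v =
    (if w {v, p v} < min (freeze_time_upto p w n (p v)) (w {v})
     then freeze_time_upto p w n (p v) else w {v})"

definition freeze_time :: "('a \<Rightarrow> 'a) \<Rightarrow> ('a \<Rightarrow> nat) \<Rightarrow> ('a set \<Rightarrow> real) \<Rightarrow> 'a \<Rightarrow> real" where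
  "freeze_time p d w v = freeze_time_upto p w (d v) v"

definition edge_opens :: "('a \<Rightarrow> 'a) \<Rightarrow> ('a \<Rightarrow> nat) \<Rightarrow> ('a set \<Rightarrow> real) \<Rightarrow> 'a set \<Rightarrow> bool" where
  "edge_opens p d w e \<longleftrightarrow> (\<forall>v\<in>e. w e < freeze_time p d w v)"

text \<open>Freezing and opening take effect at time \<open>t\<close> itself, which makes the paths
  right-continuous. At time \<infinity> all comparisons with \<open>t\<close> hold: every vertex is
  frozen, and an edge is open iff it ever opens.\<close>

definition pcf_path ::
    "'a ugraph \<Rightarrow> ('a \<Rightarrow> 'a) \<Rightarrow> ('a \<Rightarrow> nat) \<Rightarrow> ennreal \<Rightarrow> ('a set \<Rightarrow> real) \<Rightarrow> 'a config" where
  "pcf_path H p d t w =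
    (\<lambda>v\<in>verts H. if ennreal (freeze_time p d w v) \<le> t then Frozen else Warm,
     \<lambda>e\<in>edges H. ennreal (w e) \<le> t \<and> edge_opens p d w e)"

text \<open>Vertex clocks are indexed by singletons and edge clocks by edges, which have two
  elements; so one index type serves both and the cardinality tells them apart.\<close>

definition clock_rate :: "real \<Rightarrow> 'a set \<Rightarrow> real" where
  "clock_rate \<alpha> c = (if card c = 2 then 1 else \<alpha>)"

definition clocks :: "'a ugraph \<Rightarrow> 'a set set" where
  "clocks H = (\<lambda>v. {v}) ` verts H \<union> edges H"

definition cluster_of :: "'a ugraph \<Rightarrow> 'a config \<Rightarrow> 'a \<Rightarrow> 'a set" where
  "cluster_of H x v = {u \<in> verts H. (adj \<lparr>verts = verts H, edges = {e \<in> edges H. snd x e}\<rparr>)\<^sup>*\<^sup>* v u}"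

lemma clusters_eq: "clusters H x = cluster_of H x ` verts H"
  by (simp add: clusters_def components_def cluster_of_def)

lemma pcf_path_configs: "pcf_path H p d t w \<in> configs H"
  by (simp add: pcf_path_def configs_def)

lemma restrict_pcf_path:
  "verts L \<subseteq> verts H \<Longrightarrow> edges L \<subseteq> edges H \<Longrightarrow> restrict_config L (pcf_path H p d t w) = pcf_path L p d t w"
  by (auto simp: restrict_config_def pcf_path_def restrict_def fun_eq_iff)

lemma fst_pcf_path:
  "v \<in> verts H \<Longrightarrow> 0 \<le> t \<Longrightarrow>
    fst (pcf_path H p d (ennreal t) w) v = (if freeze_time p d w v \<le> t then Frozen else Warm)"
  by (simp add: pcf_path_def ennreal_le_iff)

lemma snd_pcf_path:
  "e \<in> edges H \<Longrightarrow> 0 \<le> t \<Longrightarrow> snd (pcf_path H p d (ennreal t) w) e \<longleftrightarrow> w e \<le> t \<and> edge_opens p d w e"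
  by (simp add: pcf_path_def ennreal_le_iff)

lemma configs_eqI:
  assumes "x \<in> configs H" "y \<in> configs H"
    and "\<And>v. v \<in> verts H \<Longrightarrow> fst x v = fst y v" "\<And>e. e \<in> edges H \<Longrightarrow> snd x e = snd y e"
  shows "x = y"
  using assms unfolding configs_def by (auto intro!: prod_eqI intro: PiE_ext)

lemma finite_configs:
  assumes "finite_graph H" shows "finite (configs H)"
proof -
  have "(UNIV :: vstate set) \<subseteq> {Warm, Frozen}" using vstate.exhaust by auto
  then have "finite (UNIV :: vstate set)" by (rule finite_subset) simp
  then show ?thesis
    using assms unfolding configs_def finite_graph_def
    by (intro finite_cartesian_product finite_PiE) auto
qed

lemma open_edge_configs: "x \<in> configs H \<Longrightarrow> e \<in> edges H \<Longrightarrow> open_edge e x \<in> configs H"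
  by (auto simp: configs_def open_edge_def PiE_def extensional_def)

lemma freeze_configs: "x \<in> configs H \<Longrightarrow> C \<subseteq> verts H \<Longrightarrow> freeze C x \<in> configs H"
  by (auto simp: configs_def freeze_def PiE_def extensional_def)

section \<open>Measurability of freezing times and paths\<close>

lemma freeze_time_measurable [measurable]:
  "(\<lambda>w. freeze_time p d w v) \<in> borel_measurable (clock_measure l)"
proof -
  have "(\<lambda>w. freeze_time_upto p w n v) \<in> borel_measurable (clock_measure l)" for n
    by (induction n arbitrary: v) simp_all
  then show ?thesis by (simp add: freeze_time_def)
qed

lemma edge_opens_measurable:
  "finite e \<Longrightarrow> Measurable.pred (clock_measure l) (\<lambda>w. edge_opens p d w e)"
  unfolding edge_opens_def by measurable

lemma pcf_path_vertex_measurable: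
  "(\<lambda>w. if ennreal (freeze_time p d w v) \<le> t then Frozen else Warm) \<in> clock_measure l \<rightarrow>\<^sub>M count_space UNIV"
  by measurable

lemma pcf_path_edge_measurable:
  "finite e \<Longrightarrow> (\<lambda>w. ennreal (w e) \<le> t \<and> edge_opens p d w e) \<in> clock_measure l \<rightarrow>\<^sub>M count_space UNIV"
  using edge_opens_measurable[where e = e and l = l and p = p and d = d] by measurable

lemma pcf_path_measurable_config_space:
  assumes "simple_graph H"
  shows "pcf_path H p d t \<in> clock_measure l \<rightarrow>\<^sub>M config_space H"
proof -
  have "finite e" if "e \<in> edges H" for e
    using assms that by (auto simp: simple_graph_def intro: card_ge_0_finite)
  then show ?thesis
    unfolding pcf_path_def config_space_def edge_space_def
    by (intro measurable_Pair measurable_restrict pcf_path_vertex_measurable pcf_path_edge_measurable)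
qed

lemma pcf_path_measurable:
  assumes "simple_graph H" "finite_graph H"
  shows "pcf_path H p d t \<in> clock_measure l \<rightarrow>\<^sub>M count_space (configs H)"
  unfolding measurable_count_space_eq2[OF finite_configs[OF assms(2)]]
proof (intro conjI ballI)
  show "pcf_path H p d t \<in> space (clock_measure l) \<rightarrow> configs H"
    by (simp add: pcf_path_configs)
  fix x assume x: "x \<in> configs H"
  have fe: "finite e" if "e \<in> edges H" for e
    using assms that by (auto simp: simple_graph_def intro: card_ge_0_finite)
  let ?f = "\<lambda>w v. if ennreal (freeze_time p d w v) \<le> t then Frozen else Warm"
  let ?g = "\<lambda>w e. ennreal (w e) \<le> t \<and> edge_opens p d w e"
  have "pcf_path H p d t -` {x} \<inter> space (clock_measure l) =
      {w\<in>space (clock_measure l). (\<forall>v\<in>verts H. ?f w v = fst x v) \<and> (\<forall>e\<in>edges H. ?g w e = snd x e)}"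
  proof (intro equalityI subsetI)
    fix w assume w: "w \<in> {w\<in>space (clock_measure l). (\<forall>v\<in>verts H. ?f w v = fst x v) \<and> (\<forall>e\<in>edges H. ?g w e = snd x e)}"
    have "pcf_path H p d t w = x"
      by (rule configs_eqI[OF pcf_path_configs x]) (use w in \<open>auto simp: pcf_path_def\<close>)
    then show "w \<in> pcf_path H p d t -` {x} \<inter> space (clock_measure l)" by simp
  qed (auto simp: pcf_path_def)
  also have "\<dots> \<in> sets (clock_measure l)"
  proof -
    have "{w\<in>space (clock_measure l). ?f w v = fst x v} \<in> sets (clock_measure l)" for v
      by measurable
    moreover have "{w\<in>space (clock_measure l). ?g w e = snd x e} \<in> sets (clock_measure l)" if "e \<in> edges H" for e
      using edge_opens_measurable[OF fe[OF that], where l = l and p = p and d = d] by measurable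
    ultimately show ?thesis
      using assms(2) unfolding finite_graph_def
      by (intro sets.sets_Collect_conj sets.sets_Collect_finite_All) auto
  qed
  finally show "pcf_path H p d t -` {x} \<inter> space (clock_measure l) \<in> sets (clock_measure l)" .
qed

section \<open>Freezing times on a rooted tree\<close>

context rooted_tree
begin

abbreviation "\<phi> \<equiv> freeze_time p d"
abbreviation "opens \<equiv> edge_opens p d"

lemma freeze_time_root: "\<phi> w r = w {r}"
  by (simp add: freeze_time_def depth_root)

lemma freeze_time_parent_min:
  "v \<in> verts T \<Longrightarrow> v \<noteq> r \<Longrightarrow>
    \<phi> w v = (if w {v, p v} < \<phi> w (p v) \<and> w {v, p v} < w {v} then \<phi> w (p v) else w {v})"
  using depth_parent[of v] by (simp add: freeze_time_def)

text \<open>This removes the apparent circularity that \<open>opens\<close> refers to the freezing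
  time of \<open>v\<close>, which itself depends on the edge. Under the condition on the right
  \<open>v\<close> inherits the time of its parent, and otherwise its time is \<open>w {v}\<close>;
  the equivalence holds in both cases.\<close>

lemma opens_parent:
  "v \<in> verts T \<Longrightarrow> v \<noteq> r \<Longrightarrow> opens w {v, p v} \<longleftrightarrow> w {v, p v} < \<phi> w (p v) \<and> w {v, p v} < w {v}"
  using freeze_time_parent_min[of v w] by (auto simp: edge_opens_def)

lemma freeze_time_parent:
  "v \<in> verts T \<Longrightarrow> v \<noteq> r \<Longrightarrow> \<phi> w v = (if opens w {v, p v} then \<phi> w (p v) else w {v})"
  by (simp add: freeze_time_parent_min opens_parent)

text \<open>Ensures that vertices freeze only at rings of vertex clocks: a window without such a
  ring contains no freezing time.\<close>

lemma freeze_time_clock: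
  assumes "v \<in> verts T" obtains u where "u \<in> verts T" "\<phi> w v = w {u}"
proof -
  from assms have "\<exists>u\<in>verts T. \<phi> w v = w {u}"
  proof (induction v rule: depth_induct)
    case root
    show ?case using root_in freeze_time_root by blast
  next
    case (parent v)
    then show ?case using freeze_time_parent[of v w] by (cases "opens w {v, p v}") auto
  qed
  then show ?thesis using that by blast
qed

lemma edgeE:
  assumes "e \<in> edges T"
  obtains v where "v \<in> verts T" "v \<noteq> r" "e = {v, p v}" "p v \<in> verts T"
  using assms parent_in by (auto simp: edges_eq)

lemma edge_ne_singleton: "{v} \<notin> edges T"
  using card_edge[of "{v}"] by auto

text \<open>Going down from the root, every freezing time either is unchanged or lies beyond
  \<open>t\<close> both before and after the modification. Comparisons whose outcome is visible by
  time \<open>t\<close> are therefore unaffected.\<close>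

lemma pcf_path_adapted:
  assumes s: "0 \<le> s" "s \<le> t" and c: "t < w c" "t < u"
  shows "pcf_path T p d (ennreal s) (w(c := u)) = pcf_path T p d (ennreal s) w"
proof -
  define w' where "w' = w(c := u)"
  have w': "w' c' = w c' \<or> t < w c' \<and> t < w' c'" for c'
    using c by (simp add: w'_def)
  have \<phi>: "\<phi> w' v = \<phi> w v \<or> t < \<phi> w v \<and> t < \<phi> w' v" if "v \<in> verts T" for v
    using that
  proof (induction v rule: depth_induct)
    case root
    show ?case using w'[of "{r}"] by (simp add: freeze_time_root)
  next
    case (parent v)
    show ?case
      unfolding freeze_time_parent_min[OF parent(1,2)]
      using parent.IH w'[of "{v}"] w'[of "{v, p v}"] by (auto split: if_splits)
  qed
  have "pcf_path T p d (ennreal s) w' = pcf_path T p d (ennreal s) w"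
  proof (rule configs_eqI[OF pcf_path_configs pcf_path_configs])
    fix v assume "v \<in> verts T"
    then show "fst (pcf_path T p d (ennreal s) w') v = fst (pcf_path T p d (ennreal s) w) v"
      using \<phi>[of v] s by (auto simp: fst_pcf_path simp del: ennreal_plus)
  next
    fix e assume e: "e \<in> edges T"
    have "\<phi> w' v = \<phi> w v \<or> t < \<phi> w v \<and> t < \<phi> w' v" if "v \<in> e" for v
      using \<phi> edge_subset[OF e] that by blast
    then have "w' e \<le> s \<and> opens w' e \<longleftrightarrow> w e \<le> s \<and> opens w e"
      using w'[of e] s unfolding edge_opens_def by (smt (verit, ccfv_SIG))
    then show "snd (pcf_path T p d (ennreal s) w') e = snd (pcf_path T p d (ennreal s) w) e"
      using e s by (simp add: snd_pcf_path)
  qed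
  then show ?thesis by (simp add: w'_def)
qed

lemma pcf_path_no_ring:
  assumes t: "0 \<le> t" "0 \<le> h" and none: "\<And>c. c \<in> clocks T \<Longrightarrow> w \<notin> rings c t h"
  shows "pcf_path T p d (ennreal (t + h)) w = pcf_path T p d (ennreal t) w"
proof (rule configs_eqI[OF pcf_path_configs pcf_path_configs])
  fix v assume v: "v \<in> verts T"
  obtain u where u: "u \<in> verts T" "\<phi> w v = w {u}" using freeze_time_clock[OF v] .
  have "w \<notin> rings {u} t h" by (rule none) (use u in \<open>simp add: clocks_def\<close>)
  then show "fst (pcf_path T p d (ennreal (t + h)) w) v = fst (pcf_path T p d (ennreal t) w) v"
    using t v u by (auto simp: fst_pcf_path rings_def simp del: ennreal_plus)
next
  fix e assume e: "e \<in> edges T"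
  then have "w \<notin> rings e t h" by (intro none) (simp add: clocks_def)
  then show "snd (pcf_path T p d (ennreal (t + h)) w) e = snd (pcf_path T p d (ennreal t) w) e"
    using t e by (auto simp: snd_pcf_path rings_def simp del: ennreal_plus)
qed

section \<open>Jumps caused by single rings\<close>

definition top_vertex :: "'a config \<Rightarrow> 'a \<Rightarrow> bool" where
  "top_vertex x v \<longleftrightarrow> v = r \<or> \<not> snd x {v, p v}"

text \<open>A jump may depend only on the clock and on the present state. A vertex clock acts on the
  whole cluster, but only if its vertex is the top one; all other rings are void, so that a cluster
  listens to a single clock.\<close>

definition jump :: "'a set \<Rightarrow> 'a config \<Rightarrow> 'a config" where
  "jump c x = (if c \<in> edges T then if c \<in> openable T x then open_edge c x else x
    else if top_vertex x (the_elem c) then freeze (cluster_of T x (the_elem c)) x else x)"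

lemma jump_edge: "e \<in> edges T \<Longrightarrow> jump e x = (if e \<in> openable T x then open_edge e x else x)"
  by (simp add: jump_def)

lemma jump_vertex: "jump {v} x = (if top_vertex x v then freeze (cluster_of T x v) x else x)"
  by (simp add: jump_def edge_ne_singleton)

lemma jump_configs: "x \<in> configs T \<Longrightarrow> jump c x \<in> configs T"
  by (auto simp: jump_def openable_def cluster_of_def intro!: open_edge_configs freeze_configs)

text \<open>Across an open edge the child has inherited the freezing time of its parent.\<close>

lemma freeze_time_cluster:
  assumes "u \<in> cluster_of T (pcf_path T p d (ennreal t) w) v" "0 \<le> t"
  shows "\<phi> w u = \<phi> w v"
proof -
  have "(adj \<lparr>verts = verts T, edges = {e \<in> edges T. snd (pcf_path T p d (ennreal t) w) e}\<rparr>)\<^sup>*\<^sup>* v u"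
    using assms(1) by (simp add: cluster_of_def)
  then show ?thesis
  proof (induction rule: rtranclp_induct)
    case (step a b)
    then have e: "{a, b} \<in> edges T" "opens w {a, b}"
      using assms(2) by (auto simp: adj_def snd_pcf_path)
    from e(1) obtain c where c: "c \<in> verts T" "c \<noteq> r" "{a, b} = {c, p c}" by (rule edgeE)
    then have "\<phi> w c = \<phi> w (p c)" using e(2) freeze_time_parent[of c w] by simp
    then show ?case using c(3) step.IH by (auto simp: doubleton_eq_iff)
  qed simp
qed

text \<open>The edge above \<open>v\<close> is closed at time \<open>t\<close>, and the last
  assumption prevents it from opening between \<open>t\<close> and the ring of \<open>{v}\<close>.
  It holds if \<open>{v}\<close> is the only clock to ring in the window, and also if
  \<open>{v}\<close> has rung by time \<open>t\<close>.\<close>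

lemma top_freeze_time:
  assumes v: "v \<in> verts T" and t: "0 \<le> t" and top: "top_vertex (pcf_path T p d (ennreal t) w) v"
    and e: "\<And>e. e \<in> edges T \<Longrightarrow> w e < w {v} \<Longrightarrow> w e \<le> t"
  shows "\<phi> w v = w {v}"
proof (cases "v = r")
  case False
  have "\<not> opens w {v, p v}"
  proof
    assume o: "opens w {v, p v}"
    then have "w {v, p v} < w {v}" using opens_parent[OF v False] by simp
    then have "w {v, p v} \<le> t" using e parent_edge[OF v False] by blast
    then show False
      using top o False t parent_edge[OF v False] by (simp add: top_vertex_def snd_pcf_path)
  qed
  then show ?thesis using freeze_time_parent[OF v False] by simp
qed (simp add: freeze_time_root)

lemma pcf_path_one_ring_vertex:
  assumes t: "0 \<le> t" "0 \<le> h" and v: "v \<in> verts T" and ring: "w \<in> rings {v} t h"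
    and none: "\<And>c. c \<in> clocks T \<Longrightarrow> c \<noteq> {v} \<Longrightarrow> w \<notin> rings c t h"
  shows "pcf_path T p d (ennreal (t + h)) w = jump {v} (pcf_path T p d (ennreal t) w)"
proof -
  let ?x = "pcf_path T p d (ennreal t) w"
  let ?R = "adj \<lparr>verts = verts T, edges = {e \<in> edges T. snd ?x e}\<rparr>"
  have edge: "w \<notin> rings e t h" if "e \<in> edges T" for e
    using none[of e] edge_ne_singleton that by (auto simp: clocks_def)
  have vertex: "w \<notin> rings {u} t h" if "u \<in> verts T" "u \<noteq> v" for u
    using none[of "{u}"] that by (auto simp: clocks_def)
  \<comment> \<open>The converse direction: a freezing time inside the window is traced upwards. As
    no edge rings in the window, the edges it was inherited through were open at \<open>t\<close>,
    and it stems from the only vertex clock ringing there, which is that of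
    \<open>v\<close>.\<close>
  have reach: "top_vertex ?x v \<and> ?R\<^sup>*\<^sup>* v u" if "u \<in> verts T" "t < \<phi> w u" "\<phi> w u \<le> t + h" for u
    using that
  proof (induction u rule: depth_induct)
    case root
    then have "r = v" using vertex[OF root_in] by (auto simp: freeze_time_root rings_def)
    then show ?case unfolding top_vertex_def by blast
  next
    case (parent u)
    have e: "{u, p u} \<in> edges T" using parent_edge[OF parent(1,2)] .
    show ?case
    proof (cases "opens w {u, p u}")
      case True
      then have \<phi>: "\<phi> w u = \<phi> w (p u)" using freeze_time_parent[OF parent(1,2)] by simp
      then have IH: "top_vertex ?x v" "?R\<^sup>*\<^sup>* v (p u)" using parent by auto
      have "w {u, p u} < \<phi> w (p u)" using True by (simp add: edge_opens_def)
      then have "w {u, p u} \<le> t" using edge[OF e] \<phi> parent by (auto simp: rings_def)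
      then have "?R (p u) u" using e True t by (simp add: adj_def snd_pcf_path insert_commute)
      then show ?thesis using IH by (auto intro: rtranclp.rtrancl_into_rtrancl)
    next
      case False
      then have "\<phi> w u = w {u}" using freeze_time_parent[OF parent(1,2)] by simp
      then have "u = v" using vertex[OF parent(1)] parent by (auto simp: rings_def)
      moreover have "\<not> snd ?x {u, p u}" using False e t by (simp add: snd_pcf_path)
      ultimately show ?thesis by (simp add: top_vertex_def)
    qed
  qed
  show ?thesis
  proof (rule configs_eqI[OF pcf_path_configs jump_configs[OF pcf_path_configs]])
    fix e assume e: "e \<in> edges T"
    have "snd (jump {v} ?x) e = snd ?x e" by (simp add: jump_vertex freeze_def)
    then show "snd (pcf_path T p d (ennreal (t + h)) w) e = snd (jump {v} ?x) e"
      using edge[OF e] t e by (auto simp: snd_pcf_path rings_def simp del: ennreal_plus)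
  next
    fix u assume u: "u \<in> verts T"
    show "fst (pcf_path T p d (ennreal (t + h)) w) u = fst (jump {v} ?x) u"
    proof (cases "top_vertex ?x v \<and> u \<in> cluster_of T ?x v")
      case True
      then have "\<phi> w u = \<phi> w v" using freeze_time_cluster t by blast
      also have "\<phi> w v = w {v}"
      proof (rule top_freeze_time[OF v t(1)])
        show "top_vertex ?x v" using True ..
        show "w e \<le> t" if "e \<in> edges T" "w e < w {v}" for e
          using edge[OF that(1)] that(2) ring by (auto simp: rings_def)
      qed
      finally have "\<phi> w u \<le> t + h" using ring by (simp add: rings_def)
      then show ?thesis using True t u by (simp add: fst_pcf_path jump_vertex freeze_def del: ennreal_plus)
    next
      case False
      then have "\<not> (t < \<phi> w u \<and> \<phi> w u \<le> t + h)" using reach[OF u] u by (auto simp: cluster_of_def)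
      moreover have "fst (jump {v} ?x) u = fst ?x u" using False by (auto simp: jump_vertex freeze_def)
      ultimately show ?thesis using t u by (auto simp: fst_pcf_path simp del: ennreal_plus)
    qed
  qed
qed

lemma pcf_path_one_ring_edge:
  assumes t: "0 \<le> t" "0 \<le> h" and e: "e \<in> edges T" and ring: "w \<in> rings e t h"
    and none: "\<And>c. c \<in> clocks T \<Longrightarrow> c \<noteq> e \<Longrightarrow> w \<notin> rings c t h"
  shows "pcf_path T p d (ennreal (t + h)) w = jump e (pcf_path T p d (ennreal t) w)"
proof -
  let ?x = "pcf_path T p d (ennreal t) w"
  have window: "\<not> (t < \<phi> w v \<and> \<phi> w v \<le> t + h)" if v: "v \<in> verts T" for v
  proof -
    obtain u where u: "u \<in> verts T" "\<phi> w v = w {u}" using freeze_time_clock[OF v] .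
    have "w \<notin> rings {u} t h"
      by (rule none) (use u e edge_ne_singleton in \<open>auto simp: clocks_def\<close>)
    then show ?thesis using u by (simp add: rings_def)
  qed
  show ?thesis
  proof (rule configs_eqI[OF pcf_path_configs jump_configs[OF pcf_path_configs]])
    fix v assume v: "v \<in> verts T"
    have "fst (jump e ?x) v = fst ?x v" using e by (simp add: jump_edge open_edge_def)
    then show "fst (pcf_path T p d (ennreal (t + h)) w) v = fst (jump e ?x) v"
      using window[OF v] t v by (auto simp: fst_pcf_path simp del: ennreal_plus)
  next
    fix e' assume e': "e' \<in> edges T"
    show "snd (pcf_path T p d (ennreal (t + h)) w) e' = snd (jump e ?x) e'"
    proof (cases "e' = e")
      case False
      have "w \<notin> rings e' t h" by (rule none) (use False e' in \<open>auto simp: clocks_def\<close>)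
      moreover have "snd (jump e ?x) e' = snd ?x e'" using False e by (simp add: jump_edge open_edge_def)
      ultimately show ?thesis using t e' by (auto simp: snd_pcf_path rings_def simp del: ennreal_plus)
    next
      case True
      \<comment> \<open>No vertex freezes in the window, so an end that is warm at \<open>t\<close>
        is still warm when \<open>e\<close> rings.\<close>
      have "w e < \<phi> w v \<longleftrightarrow> t < \<phi> w v" if "v \<in> e" for v
        using window[of v] edge_subset[OF e] that ring by (fastforce simp: rings_def)
      then have "opens w e \<longleftrightarrow> (\<forall>v\<in>e. t < \<phi> w v)" by (auto simp: edge_opens_def)
      also have "\<dots> \<longleftrightarrow> (\<forall>v\<in>e. fst ?x v = Warm)"
        using edge_subset[OF e] t by (auto simp: fst_pcf_path subset_iff not_le)
      also have "\<dots> \<longleftrightarrow> e \<in> openable T ?x"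
        using ring e t by (auto simp: openable_def snd_pcf_path rings_def simp del: ennreal_plus)
      finally have "opens w e \<longleftrightarrow> e \<in> openable T ?x" .
      then show ?thesis
        using True ring e t by (auto simp: jump_edge open_edge_def snd_pcf_path rings_def simp del: ennreal_plus)
    qed
  qed
qed

text \<open>If the clock of an edge has rung and both ends are still warm, the edge has opened and
  is no longer openable. If the clock of a top vertex has rung, its cluster is frozen
  already.\<close>

lemma pcf_path_rung:
  assumes t: "0 \<le> t" and c: "c \<in> clocks T" "w c \<le> t"
  shows "jump c (pcf_path T p d (ennreal t) w) = pcf_path T p d (ennreal t) w"
proof -
  let ?x = "pcf_path T p d (ennreal t) w"
  from c(1) consider (edge) "c \<in> edges T" | (vertex) v where "v \<in> verts T" "c = {v}"
    by (auto simp: clocks_def)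
  then show ?thesis
  proof cases
    case edge
    have "c \<notin> openable T ?x"
    proof
      assume o: "c \<in> openable T ?x"
      have "t < \<phi> w v" if "v \<in> c" for v
        using o that edge_subset[OF edge] t by (auto simp: openable_def fst_pcf_path subset_iff split: if_splits)
      then have "opens w c" using c(2) by (force simp: edge_opens_def)
      then show False using o edge t c(2) by (auto simp: openable_def snd_pcf_path)
    qed
    then show ?thesis using edge by (simp add: jump_edge)
  next
    case vertex
    show ?thesis
    proof (cases "top_vertex ?x v")
      case True
      have "\<phi> w v = w {v}"
        by (rule top_freeze_time[OF vertex(1) t True]) (use c vertex in auto)
      then have "fst ?x u = Frozen" if "u \<in> cluster_of T ?x v" for u
        using freeze_time_cluster[OF that t] that c vertex t by (simp add: cluster_of_def fst_pcf_path)
      then have "freeze (cluster_of T ?x v) ?x = ?x"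
        by (auto simp: freeze_def fun_eq_iff intro!: prod_eqI)
      then show ?thesis using vertex by (simp add: jump_vertex)
    next
      case False
      then show ?thesis using vertex by (simp add: jump_vertex)
    qed
  qed
qed

section \<open>Top vertices of clusters and the PCF generator\<close>

lemma cluster_of_top:
  assumes "v \<in> verts T"
  obtains u where "u \<in> verts T" "top_vertex x u" "cluster_of T x u = cluster_of T x v"
proof -
  let ?R = "adj \<lparr>verts = verts T, edges = {e \<in> edges T. snd x e}\<rparr>"
  from assms have "\<exists>u\<in>verts T. top_vertex x u \<and> cluster_of T x u = cluster_of T x v"
  proof (induction v rule: depth_induct)
    case root
    show ?case using root_in by (auto simp: top_vertex_def)
  next
    case (parent v)
    show ?case
    proof (cases "top_vertex x v")
      case False
      then have R: "?R v (p v)" "?R (p v) v"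
        using parent_edge[OF parent(1,2)] by (auto simp: top_vertex_def adj_def insert_commute)
      have "?R\<^sup>*\<^sup>* (p v) a \<longleftrightarrow> ?R\<^sup>*\<^sup>* v a" for a
        using converse_rtranclp_into_rtranclp[of ?R, OF R(1)] converse_rtranclp_into_rtranclp[of ?R, OF R(2)] by blast
      then have "cluster_of T x (p v) = cluster_of T x v" by (simp add: cluster_of_def)
      then show ?thesis using parent.IH by simp
    qed (use parent in blast)
  qed
  then show ?thesis using that by blast
qed

text \<open>Two top vertices of one cluster reach each other along open edges, so each climbs to the
  other, and the depths force equality. With \<open>cluster_of_top\<close> this matches clusters
  with top vertices, for every configuration.\<close>

lemma inj_on_cluster_of_top: "inj_on (cluster_of T x) {v \<in> verts T. top_vertex x v}"
proof (rule inj_onI)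
  fix u v assume u: "u \<in> {v \<in> verts T. top_vertex x v}" and v: "v \<in> {v \<in> verts T. top_vertex x v}"
    and eq: "cluster_of T x u = cluster_of T x v"
  have climb: "climbs\<^sup>*\<^sup>* b a" if "top_vertex x a" "b \<in> cluster_of T x a" for a b
    using that reach_climbs[of "\<lparr>verts = verts T, edges = {e \<in> edges T. snd x e}\<rparr>" a b]
    by (auto simp: top_vertex_def cluster_of_def)
  have "u \<in> cluster_of T x v" "v \<in> cluster_of T x u"
    using u v eq by (auto simp: cluster_of_def)
  then show "u = v"
    using climb[of u v] climb[of v u] u v climbs_depth[of u v] climbs_depth[of v u] by auto
qed

text \<open>The sum over clusters becomes a sum over top vertices. Void rings have
  \<open>jump c x = x\<close> and contribute zero, so both sums extend to all clocks. Transitions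
  that do not change \<open>x\<close>, such as freezing a frozen cluster, cancel in the
  generator.\<close>

lemma generator_PCF_rate:
  assumes fin: "finite (verts T)" and x: "x \<in> configs T" and y: "y \<in> configs T"
  shows "generator (configs T) (PCF_rate T \<alpha>) x y =
    (\<Sum>c\<in>clocks T. clock_rate \<alpha> c * (of_bool (y = jump c x) - of_bool (y = x)))"
proof -
  let ?S = "configs T" and ?V = "{v \<in> verts T. top_vertex x v}"
  have finE: "finite (edges T)" using finite_edges[OF fin] .
  have finS: "finite ?S" using fin finE by (intro finite_configs) (simp add: finite_graph_def)
  have cl: "clusters T x = cluster_of T x ` ?V"
  proof -
    have "cluster_of T x v \<in> cluster_of T x ` ?V" if "v \<in> verts T" for v
    proof -
      obtain u where "u \<in> verts T" "top_vertex x u" "cluster_of T x u = cluster_of T x v"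
        using cluster_of_top[OF \<open>v \<in> verts T\<close>] .
      then show ?thesis by (intro image_eqI[of _ _ u]) auto
    qed
    then show ?thesis unfolding clusters_eq by blast
  qed
  have sum_cl: "(\<Sum>C\<in>clusters T x. f C) = (\<Sum>v\<in>?V. f (cluster_of T x v))" for f :: "'a set \<Rightarrow> real"
    unfolding cl by (simp add: sum.reindex[OF inj_on_cluster_of_top])
  have rate: "PCF_rate T \<alpha> x z = (\<Sum>e\<in>openable T x. of_bool (z = open_edge e x)) +
      (\<Sum>v\<in>?V. \<alpha> * of_bool (z = freeze (cluster_of T x v) x))" for z
    by (simp add: PCF_rate_def sum_cl)
  have one: "(\<Sum>z\<in>?S. of_bool (z = a)) = (1::real)" if "a \<in> ?S" for a
    using finS that by (simp add: of_bool_def)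
  have finO: "finite (openable T x)" using finE by (simp add: openable_def)
  have "(\<Sum>z\<in>?S. PCF_rate T \<alpha> x z) = (\<Sum>e\<in>openable T x. \<Sum>z\<in>?S. of_bool (z = open_edge e x)) +
      (\<Sum>v\<in>?V. \<alpha> * (\<Sum>z\<in>?S. of_bool (z = freeze (cluster_of T x v) x)))"
    unfolding rate sum.distrib by (simp add: sum.swap[of _ ?S] sum_distrib_left)
  also have "\<dots> = (\<Sum>e\<in>openable T x. 1) + (\<Sum>v\<in>?V. \<alpha> * 1)"
    using x by (intro arg_cong2[where f = "(+)"] sum.cong refl arg_cong2[where f = "(*)"] one
        open_edge_configs freeze_configs) (auto simp: openable_def cluster_of_def)
  finally have total: "(\<Sum>z\<in>?S. PCF_rate T \<alpha> x z) = (\<Sum>e\<in>openable T x. 1) + (\<Sum>v\<in>?V. \<alpha> * 1)" .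
  have edges: "(\<Sum>e\<in>edges T. of_bool (y = jump e x) - of_bool (y = x)) =
      (\<Sum>e\<in>openable T x. of_bool (y = open_edge e x) - (of_bool (y = x) :: real))"
    using finE by (intro sum.mono_neutral_cong_right) (auto simp: openable_def jump_edge)
  have vertices: "(\<Sum>v\<in>verts T. \<alpha> * (of_bool (y = jump {v} x) - of_bool (y = x))) =
      (\<Sum>v\<in>?V. \<alpha> * (of_bool (y = freeze (cluster_of T x v) x) - of_bool (y = x)))"
    using fin by (intro sum.mono_neutral_cong_right) (auto simp: jump_vertex)
  have "(\<Sum>c\<in>clocks T. clock_rate \<alpha> c * (of_bool (y = jump c x) - of_bool (y = x))) =
      (\<Sum>v\<in>verts T. \<alpha> * (of_bool (y = jump {v} x) - of_bool (y = x))) +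
      (\<Sum>e\<in>edges T. of_bool (y = jump e x) - of_bool (y = x))"
    unfolding clocks_def using fin finE edge_ne_singleton
    by (subst sum.union_disjoint) (auto simp: sum.reindex clock_rate_def card_edge)
  also have "\<dots> = generator ?S (PCF_rate T \<alpha>) x y"
    unfolding edges vertices generator_def total unfolding rate
    by (simp add: sum_subtractf right_diff_distrib eq_commute[of x y])
  finally show ?thesis by simp
qed

text \<open>Only almost sure, because the sample space also contains functions with nonpositive
  values.\<close>

lemma AE_pcf_path_0:
  assumes "finite (verts T)" "\<alpha> > 0"
  shows "AE w in clock_measure (clock_rate \<alpha>). pcf_path T p d (ennreal 0) w = initial_config T"
proof -
  interpret exponential_clocks "clock_rate \<alpha> :: 'a set \<Rightarrow> real"
    using assms(2) by unfold_locales (simp add: clock_rate_def)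
  have "finite (clocks T)" using assms(1) finite_edges by (simp add: clocks_def)
  then have "AE w in clock_measure (clock_rate \<alpha>). \<forall>c\<in>clocks T. 0 < w c"
    by (intro AE_finite_allI AE_clock_pos)
  then show ?thesis
  proof (rule AE_mp, intro AE_I2 impI configs_eqI[OF pcf_path_configs])
    fix w :: "'a set \<Rightarrow> real" assume w: "\<forall>c\<in>clocks T. 0 < w c"
    show "initial_config T \<in> configs T" by (simp add: initial_config_def configs_def)
    show "fst (pcf_path T p d (ennreal 0) w) v = fst (initial_config T) v" if v: "v \<in> verts T" for v
    proof -
      obtain u where "u \<in> verts T" "\<phi> w v = w {u}" using freeze_time_clock[OF v] .
      then have "0 < \<phi> w v" using w by (simp add: clocks_def)
      then show ?thesis using v fst_pcf_path[OF v order_refl] by (simp add: initial_config_def)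
    qed
    show "snd (pcf_path T p d (ennreal 0) w) e = snd (initial_config T) e" if e: "e \<in> edges T" for e
      using w e snd_pcf_path[OF e order_refl] by (force simp: initial_config_def clocks_def)
  qed
qed

lemma clock_driven_pcf_path:
  assumes fin: "finite (verts T)" and \<alpha>: "\<alpha> > 0"
  shows "clock_driven (clock_rate \<alpha>) (clocks T) (configs T) (\<lambda>t. pcf_path T p d (ennreal t))
    jump (initial_config T) (PCF_rate T \<alpha>)"
proof -
  interpret exponential_clocks "clock_rate \<alpha> :: 'a set \<Rightarrow> real"
    using \<alpha> by unfold_locales (simp add: clock_rate_def)
  have fg: "finite_graph T" using fin finite_edges by (simp add: finite_graph_def)
  show ?thesis
  proof
    show "finite (clocks T)" using fin finite_edges by (simp add: clocks_def)
    show "finite (configs T)" by (rule finite_configs[OF fg])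
    show "pcf_path T p d (ennreal t) \<in> clock_measure (clock_rate \<alpha>) \<rightarrow>\<^sub>M count_space (configs T)" for t
      by (rule pcf_path_measurable[OF simple fg])
    show "AE w in clock_measure (clock_rate \<alpha>). pcf_path T p d (ennreal 0) w = initial_config T"
      by (rule AE_pcf_path_0[OF fin \<alpha>])
  next
    fix s t u :: real and w :: "'a set \<Rightarrow> real" and c assume "0 \<le> s" "s \<le> t" "t < w c" "t < u"
    then show "pcf_path T p d (ennreal s) (w(c := u)) = pcf_path T p d (ennreal s) w"
      by (rule pcf_path_adapted)
  next
    fix t h :: real and w assume "0 \<le> t" "0 \<le> h" "\<And>c. c \<in> clocks T \<Longrightarrow> w \<notin> rings c t h"
    then show "pcf_path T p d (ennreal (t + h)) w = pcf_path T p d (ennreal t) w"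
      by (rule pcf_path_no_ring)
  next
    fix t h :: real and c w assume *: "0 \<le> t" "0 \<le> h" "c \<in> clocks T" "w \<in> rings c t h"
      "\<And>c'. c' \<in> clocks T \<Longrightarrow> c' \<noteq> c \<Longrightarrow> w \<notin> rings c' t h"
    from *(3) consider "c \<in> edges T" | v where "v \<in> verts T" "c = {v}" by (auto simp: clocks_def)
    then show "pcf_path T p d (ennreal (t + h)) w = jump c (pcf_path T p d (ennreal t) w)"
      using *
      by cases (auto intro!: pcf_path_one_ring_edge pcf_path_one_ring_vertex simp del: ennreal_plus)
  next
    fix t :: real and c w assume "0 \<le> t" "c \<in> clocks T" "w c \<le> t"
    then show "jump c (pcf_path T p d (ennreal t) w) = pcf_path T p d (ennreal t) w"
      by (rule pcf_path_rung)
  next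
    fix x y assume "x \<in> configs T" "y \<in> configs T"
    then show "generator (configs T) (PCF_rate T \<alpha>) x y =
        (\<Sum>c\<in>clocks T. clock_rate \<alpha> c * (of_bool (y = jump c x) - of_bool (y = x)))"
      by (rule generator_PCF_rate[OF fin])
  qed
qed

end

section \<open>The law of a finite-state chain on cadlag paths\<close>

lemma cadlag_process_prob_space: "cadlag_process S M X \<Longrightarrow> prob_space M"
  and cadlag_process_measurable: "cadlag_process S M X \<Longrightarrow> X t \<in> M \<rightarrow>\<^sub>M count_space S"
  by (auto simp: cadlag_process_def)

lemma cadlag_process_sets:
  assumes "cadlag_process S M X" shows "{\<omega> \<in> space M. P (X t \<omega>)} \<in> sets M"
proof -
  have X: "X t \<in> M \<rightarrow>\<^sub>M count_space S" using cadlag_process_measurable[OF assms] .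
  have "X t -` {x\<in>S. P x} \<inter> space M \<in> sets M" using X by (rule measurable_sets) auto
  moreover have "X t -` {x\<in>S. P x} \<inter> space M = {\<omega> \<in> space M. P (X t \<omega>)}"
    using measurable_space[OF X] by auto
  ultimately show ?thesis by simp
qed

lemma cadlag_process_sets_finite:
  assumes "cadlag_process S M X" "finite I"
  shows "{\<omega> \<in> space M. \<forall>i\<in>I. P i (X (t i) \<omega>)} \<in> sets M"
  using assms by (intro sets.sets_Collect_finite_All cadlag_process_sets)

lemma cadlag_process_path_measurable:
  assumes "cadlag_process S M X"
  shows "(\<lambda>\<omega> t. X t \<omega>) \<in> M \<rightarrow>\<^sub>M (\<Pi>\<^sub>M t\<in>UNIV. count_space S)"
  using measurable_restrict[of UNIV "\<lambda>t \<omega>. X t \<omega>" M "\<lambda>_. count_space S"]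
    cadlag_process_measurable[OF assms] by (simp add: restrict_UNIV)

lemma cadlag_comp:
  assumes "cadlag x" shows "cadlag (\<lambda>t. f (x t))"
  unfolding cadlag_def
proof (intro allI conjI)
  fix t
  have "\<forall>\<^sub>F s in at_right t. x s = x t" using assms by (simp add: cadlag_def)
  then show "\<forall>\<^sub>F s in at_right t. f (x s) = f (x t)" by eventually_elim simp
  obtain c where "\<forall>\<^sub>F s in at_left t. x s = c" using assms by (auto simp: cadlag_def)
  then have "\<forall>\<^sub>F s in at_left t. f (x s) = f c" by eventually_elim simp
  then show "\<exists>c. \<forall>\<^sub>F s in at_left t. f (x s) = c" ..
qed

lemma cadlag_process_comp:
  assumes X: "cadlag_process S M X" and f: "f \<in> S \<rightarrow> S'"
  shows "cadlag_process S' M (\<lambda>t \<omega>. f (X t \<omega>))"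
proof -
  have "(\<lambda>\<omega>. f (X t \<omega>)) \<in> M \<rightarrow>\<^sub>M count_space S'" for t
    by (rule measurable_compose[OF cadlag_process_measurable[OF X]]) (use f in auto)
  moreover have "cadlag (\<lambda>t. f (X t \<omega>))" if "\<omega> \<in> space M" for \<omega>
    using X that cadlag_comp[of "\<lambda>t. X t \<omega>" f] by (simp add: cadlag_process_def)
  ultimately show ?thesis using X by (simp add: cadlag_process_def)
qed

lemma fdd_sum_atoms:
  fixes s :: "nat \<Rightarrow> ennreal"
  assumes X: "cadlag_process S M X" and S: "finite S"
  shows "measure M {\<omega> \<in> space M. \<forall>i\<le>k. X (s i) \<omega> \<in> B i} =
    (\<Sum>x\<in>PiE {..k} (\<lambda>i. B i \<inter> S). measure M {\<omega> \<in> space M. \<forall>i\<le>k. X (s i) \<omega> = x i})"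
proof -
  interpret prob_space M using cadlag_process_prob_space[OF X] .
  let ?E = "\<lambda>x. {\<omega> \<in> space M. \<forall>i\<le>k. X (s i) \<omega> = x i}"
  have "{\<omega> \<in> space M. \<forall>i\<le>k. X (s i) \<omega> \<in> B i} = (\<Union>x\<in>PiE {..k} (\<lambda>i. B i \<inter> S). ?E x)"
  proof (intro equalityI subsetI)
    fix \<omega> assume "\<omega> \<in> {\<omega> \<in> space M. \<forall>i\<le>k. X (s i) \<omega> \<in> B i}"
    then have "(\<lambda>i\<in>{..k}. X (s i) \<omega>) \<in> PiE {..k} (\<lambda>i. B i \<inter> S)" "\<omega> \<in> ?E (\<lambda>i\<in>{..k}. X (s i) \<omega>)"
      using measurable_space[OF cadlag_process_measurable[OF X]] by auto
    then show "\<omega> \<in> (\<Union>x\<in>PiE {..k} (\<lambda>i. B i \<inter> S). ?E x)" by blast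
  qed (auto simp: PiE_def Pi_def)
  also have "prob \<dots> = (\<Sum>x\<in>PiE {..k} (\<lambda>i. B i \<inter> S). prob (?E x))"
  proof (rule finite_measure_finite_Union)
    show "finite (PiE {..k} (\<lambda>i. B i \<inter> S))" using S by (intro finite_PiE) auto
    have "?E x \<in> sets M" for x
      using cadlag_process_sets_finite[OF X finite_atMost[of k], of "\<lambda>i y. y = x i" s]
      unfolding Ball_def atMost_iff .
    then show "?E ` PiE {..k} (\<lambda>i. B i \<inter> S) \<subseteq> sets M" by (intro image_subsetI)
    show "disjoint_family_on ?E (PiE {..k} (\<lambda>i. B i \<inter> S))"
      unfolding disjoint_family_on_def
    proof (intro ballI impI)
      fix x y assume "x \<in> PiE {..k} (\<lambda>i. B i \<inter> S)" "y \<in> PiE {..k} (\<lambda>i. B i \<inter> S)" "x \<noteq> y"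
      then have "\<exists>i\<in>{..k}. x i \<noteq> y i" using PiE_ext by metis
      then show "?E x \<inter> ?E y = {}" by auto
    qed
  qed
  finally show ?thesis .
qed

lemma markov_chain_fdd:
  assumes "markov_chain S q x\<^sub>0 M X"
    and "0 \<le> t 0 \<and> (\<forall>i<k. t i \<le> t (Suc i)) \<and> (\<forall>i\<le>k. x i \<in> S)"
  shows "measure M {\<omega> \<in> space M. \<forall>i\<le>k. X (ennreal (t i)) \<omega> = x i} =
    transition_prob S q (t 0) x\<^sub>0 (x 0) * (\<Prod>i<k. transition_prob S q (t (Suc i) - t i) (x i) (x (Suc i)))"
  using assms unfolding markov_chain_def by blast

text \<open>\<open>markov_chain\<close> prescribes probabilities of single states along
  nondecreasing real times. A finite set of finite times is brought into this form by sorting, and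
  general events by summing over atoms.\<close>

lemma markov_chain_fdd_eq_finite:
  assumes M: "markov_chain S q x\<^sub>0 M X" and N: "markov_chain S q x\<^sub>0 N Y" and S: "finite S"
    and J: "finite J" "\<infinity> \<notin> J"
  shows "measure M {\<omega> \<in> space M. \<forall>j\<in>J. X j \<omega> \<in> A j} = measure N {\<omega> \<in> space N. \<forall>j\<in>J. Y j \<omega> \<in> A j}"
proof (cases "J = {}")
  case True
  then show ?thesis
    using M N prob_space.prob_space[of M] prob_space.prob_space[of N]
    by (simp add: markov_chain_def cadlag_process_def)
next
  case False
  define ts where "ts = sorted_list_of_set (enn2real ` J)"
  define k where "k = length ts - 1"
  have ts: "set ts = enn2real ` J" "sorted ts" using J by (simp_all add: ts_def)
  then have "ts \<noteq> []" using False by auto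
  then have idx: "i \<le> k \<longleftrightarrow> i < length ts" for i unfolding k_def by (cases ts) auto
  have J_eq: "J = (\<lambda>i. ennreal (ts ! i)) ` {..k}"
  proof -
    have "ennreal (enn2real j) = j" if "j \<in> J" for j
      using J(2) that by (metis ennreal_enn2real infinity_ennreal_def less_top)
    then have "J = (\<lambda>x. ennreal (enn2real x)) ` J" by simp
    also have "\<dots> = ennreal ` set ts" by (simp add: ts image_image)
    also have "set ts = (!) ts ` {..k}" using idx by (auto simp: set_conv_nth)
    finally show ?thesis by (simp add: image_image)
  qed
  have nonneg: "0 \<le> ts ! i" if "i \<le> k" for i
  proof -
    have "ts ! i \<in> enn2real ` J" using that idx ts(1) nth_mem by blast
    then show ?thesis by auto
  qed
  have mono: "ts ! i \<le> ts ! Suc i" if "i < k" for i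
    using sorted_nth_mono[OF ts(2), of i "Suc i"] that idx[of "Suc i"] by simp
  have X: "cadlag_process S M X" and Y: "cadlag_process S N Y" using M N by (simp_all add: markov_chain_def)
  have atoms: "measure M {\<omega> \<in> space M. \<forall>i\<le>k. X (ennreal (ts ! i)) \<omega> = x i} =
      measure N {\<omega> \<in> space N. \<forall>i\<le>k. Y (ennreal (ts ! i)) \<omega> = x i}" if "\<forall>i\<le>k. x i \<in> S" for x
  proof -
    have *: "0 \<le> ts ! 0 \<and> (\<forall>i<k. ts ! i \<le> ts ! Suc i) \<and> (\<forall>i\<le>k. x i \<in> S)"
      using nonneg mono that by simp
    show ?thesis
      using markov_chain_fdd[where t = "(!) ts", OF M *] markov_chain_fdd[where t = "(!) ts", OF N *] by simp
  qed
  have "measure M {\<omega> \<in> space M. \<forall>i\<le>k. X (ennreal (ts ! i)) \<omega> \<in> A (ennreal (ts ! i))} =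
      measure N {\<omega> \<in> space N. \<forall>i\<le>k. Y (ennreal (ts ! i)) \<omega> \<in> A (ennreal (ts ! i))}"
    unfolding fdd_sum_atoms[OF X S, of k "\<lambda>i. ennreal (ts ! i)" "\<lambda>i. A (ennreal (ts ! i))"]
      fdd_sum_atoms[OF Y S, of k "\<lambda>i. ennreal (ts ! i)" "\<lambda>i. A (ennreal (ts ! i))"]
    by (intro sum.cong refl atoms) (simp add: PiE_iff)
  moreover have "(\<forall>j\<in>J. P j) \<longleftrightarrow> (\<forall>i\<le>k. P (ennreal (ts ! i)))" for P unfolding J_eq by auto
  ultimately show ?thesis by simp
qed

lemma filterlim_of_nat_at_left_infinity:
  "filterlim (\<lambda>n. of_nat n :: ennreal) (at_left \<infinity>) sequentially"
  unfolding filterlim_at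
  using of_nat_tendsto_top_ennreal by (simp add: less_top[symmetric])

text \<open>Almost every path is constant near \<infinity> with the final state as its value, so
  dominated convergence carries identities at finite times over to time \<infinity>.\<close>

lemma markov_chain_fdd_tendsto:
  assumes M: "markov_chain S q x\<^sub>0 M X" and J: "finite J"
  shows "(\<lambda>n. measure M {\<omega> \<in> space M. (\<forall>j\<in>J. X j \<omega> \<in> A j) \<and> X (of_nat n) \<omega> \<in> B}) \<longlonglongrightarrow>
    measure M {\<omega> \<in> space M. (\<forall>j\<in>J. X j \<omega> \<in> A j) \<and> X \<infinity> \<omega> \<in> B}"
proof -
  have X: "cadlag_process S M X" using M by (simp add: markov_chain_def)
  interpret prob_space M using cadlag_process_prob_space[OF X] .
  let ?E = "\<lambda>t. {\<omega> \<in> space M. (\<forall>j\<in>J. X j \<omega> \<in> A j) \<and> X t \<omega> \<in> B}"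
  have E: "?E t \<in> sets M" for t
    using J by (intro sets.sets_Collect_conj sets.sets_Collect_finite_All cadlag_process_sets[OF X])
  have "AE \<omega> in M. \<forall>\<^sub>F s in at_left \<infinity>. X s \<omega> = X \<infinity> \<omega>" using M by (simp add: markov_chain_def)
  then have "AE \<omega> in M. (\<lambda>n. indicator (?E (of_nat n)) \<omega> :: real) \<longlonglongrightarrow> indicator (?E \<infinity>) \<omega>"
  proof eventually_elim
    case (elim \<omega>)
    then have "\<forall>\<^sub>F n in sequentially. X (of_nat n) \<omega> = X \<infinity> \<omega>"
      using filterlim_of_nat_at_left_infinity by (rule eventually_compose_filterlim)
    then have "\<forall>\<^sub>F n in sequentially. indicator (?E (of_nat n)) \<omega> = (indicator (?E \<infinity>) \<omega> :: real)"
      by eventually_elim (simp add: indicator_def)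
    then show ?case by (rule tendsto_eventually)
  qed
  then have "(\<lambda>n. \<integral>\<omega>. indicator (?E (of_nat n)) \<omega> \<partial>M :: real) \<longlonglongrightarrow> (\<integral>\<omega>. indicator (?E \<infinity>) \<omega> \<partial>M)"
    using E by (intro integral_dominated_convergence[where w = "\<lambda>_. 1"]) (auto simp: indicator_def)
  then show ?thesis using E by simp
qed

lemma markov_chain_fdd_eq:
  assumes M: "markov_chain S q x\<^sub>0 M X" and N: "markov_chain S q x\<^sub>0 N Y" and S: "finite S"
    and J: "finite J"
  shows "measure M {\<omega> \<in> space M. \<forall>j\<in>J. X j \<omega> \<in> A j} = measure N {\<omega> \<in> space N. \<forall>j\<in>J. Y j \<omega> \<in> A j}"
proof (cases "\<infinity> \<in> J")
  case False
  then show ?thesis using markov_chain_fdd_eq_finite[OF M N S J] by simp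
next
  case True
  define J0 where "J0 = J - {\<infinity>}"
  have J0: "finite J0" "\<infinity> \<notin> J0" "J = insert \<infinity> J0" using J True by (auto simp: J0_def)
  have split: "(\<forall>j\<in>J. Z j \<in> A j) \<longleftrightarrow> (\<forall>j\<in>J0. Z j \<in> A j) \<and> Z \<infinity> \<in> A \<infinity>" for Z
    using J0(3) by auto
  have eq: "measure M {\<omega> \<in> space M. (\<forall>j\<in>J0. X j \<omega> \<in> A j) \<and> X (of_nat n) \<omega> \<in> A \<infinity>} =
      measure N {\<omega> \<in> space N. (\<forall>j\<in>J0. Y j \<omega> \<in> A j) \<and> Y (of_nat n) \<omega> \<in> A \<infinity>}" for n :: nat
  proof -
    \<comment> \<open>The time \<open>of_nat n\<close> may already belong to \<open>J0\<close>; both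
      constraints are then imposed at once.\<close>
    define A' where "A' j = (if j \<in> J0 then A j else UNIV) \<inter> (if j = of_nat n then A \<infinity> else UNIV)" for j
    have iff: "(\<forall>j\<in>insert (of_nat n) J0. Z j \<in> A' j) \<longleftrightarrow> (\<forall>j\<in>J0. Z j \<in> A j) \<and> Z (of_nat n) \<in> A \<infinity>" for Z
      by (auto simp: A'_def)
    show ?thesis
      using markov_chain_fdd_eq_finite[OF M N S, of "insert (of_nat n) J0" A'] J0(1,2) unfolding iff by simp
  qed
  show ?thesis
    unfolding split
    using markov_chain_fdd_tendsto[OF M J0(1), of A "A \<infinity>"] markov_chain_fdd_tendsto[OF N J0(1), of A "A \<infinity>"]
    unfolding eq by (rule LIMSEQ_unique)
qed

lemma cadlag_process_vimage_cylinder: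
  assumes X: "cadlag_process S M X"
  shows "(\<lambda>\<omega> t. X t \<omega>) -` prod_emb UNIV (\<lambda>_. count_space S) J (Pi\<^sub>E J A) \<inter> space M =
    {\<omega> \<in> space M. \<forall>j\<in>J. X j \<omega> \<in> A j}"
proof -
  have "X t \<omega> \<in> S" if "\<omega> \<in> space M" for t \<omega>
    using measurable_space[OF cadlag_process_measurable[OF X] that, of t] by simp
  then show ?thesis by (auto simp: prod_emb_iff restrict_PiE_iff)
qed

text \<open>Test functionals in \<open>converges_in_law\<close> are measurable for the product
  sigma-algebra, so equality of laws is needed only there, and cylinders over finitely many times
  generate it.\<close>

lemma markov_chain_law_unique:
  assumes M: "markov_chain S q x\<^sub>0 M X" and N: "markov_chain S q x\<^sub>0 N Y" and S: "finite S"
  shows "distr M (\<Pi>\<^sub>M t\<in>UNIV. count_space S) (\<lambda>\<omega> t. X t \<omega>) =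
    distr N (\<Pi>\<^sub>M t\<in>UNIV. count_space S) (\<lambda>\<omega> t. Y t \<omega>)"
proof (rule measure_eqI_PiM_infinite)
  let ?P = "\<Pi>\<^sub>M t\<in>(UNIV :: ennreal set). count_space S"
  have X: "cadlag_process S M X" and Y: "cadlag_process S N Y" using M N by (simp_all add: markov_chain_def)
  interpret M: prob_space M using cadlag_process_prob_space[OF X] .
  interpret N: prob_space N using cadlag_process_prob_space[OF Y] .
  note mX = cadlag_process_path_measurable[OF X] and mY = cadlag_process_path_measurable[OF Y]
  show "finite_measure (distr M ?P (\<lambda>\<omega> t. X t \<omega>))"
    using M.prob_space_distr[OF mX] by (simp add: prob_space_def)
  fix A :: "ennreal \<Rightarrow> _ set" and J assume J: "finite J" "J \<subseteq> UNIV" and A: "\<And>i. i \<in> J \<Longrightarrow> A i \<in> sets (count_space S)"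
  let ?B = "prod_emb UNIV (\<lambda>_. count_space S) J (Pi\<^sub>E J A)"
  have B: "?B \<in> sets ?P" using J A by (intro sets_PiM_I) auto
  have "emeasure (distr M ?P (\<lambda>\<omega> t. X t \<omega>)) ?B = emeasure M {\<omega> \<in> space M. \<forall>j\<in>J. X j \<omega> \<in> A j}"
    unfolding emeasure_distr[OF mX B] cadlag_process_vimage_cylinder[OF X] ..
  also have "\<dots> = emeasure N {\<omega> \<in> space N. \<forall>j\<in>J. Y j \<omega> \<in> A j}"
    using markov_chain_fdd_eq[OF M N S J(1)] by (simp add: M.emeasure_eq_measure N.emeasure_eq_measure)
  also have "\<dots> = emeasure (distr N ?P (\<lambda>\<omega> t. Y t \<omega>)) ?B"
    unfolding emeasure_distr[OF mY B] cadlag_process_vimage_cylinder[OF Y] ..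
  finally show "emeasure (distr M ?P (\<lambda>\<omega> t. X t \<omega>)) ?B = emeasure (distr N ?P (\<lambda>\<omega> t. Y t \<omega>)) ?B" .
qed simp_all

lemma markov_chain_integral_eq:
  assumes M: "markov_chain S q x\<^sub>0 M X" and N: "markov_chain S q x\<^sub>0 N Y" and S: "finite S"
    and f: "f \<in> S \<rightarrow> S'" and F: "F \<in> borel_measurable (Pi\<^sub>M UNIV (\<lambda>_. count_space S'))"
  shows "(\<integral>\<omega>. F (\<lambda>t. f (X t \<omega>)) \<partial>M) = (\<integral>\<omega>. (F (\<lambda>t. f (Y t \<omega>)) :: real) \<partial>N)"
proof -
  let ?P = "\<Pi>\<^sub>M t\<in>(UNIV :: ennreal set). count_space S"
  have X: "cadlag_process S M X" and Y: "cadlag_process S N Y" using M N by (simp_all add: markov_chain_def)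
  have "(\<lambda>x t. f (x t)) \<in> ?P \<rightarrow>\<^sub>M Pi\<^sub>M UNIV (\<lambda>_. count_space S')"
  proof -
    have "(\<lambda>x. f (x t)) \<in> ?P \<rightarrow>\<^sub>M count_space S'" for t
      by (rule measurable_compose[OF measurable_component_singleton[of t UNIV]]) (use f in auto)
    then show ?thesis
      using measurable_restrict[of UNIV "\<lambda>t x. f (x t)" ?P "\<lambda>_. count_space S'"] by (simp add: restrict_UNIV)
  qed
  then have G: "(\<lambda>x. F (\<lambda>t. f (x t))) \<in> borel_measurable ?P" using F by (rule measurable_compose)
  have "(\<integral>\<omega>. F (\<lambda>t. f (X t \<omega>)) \<partial>M) = (\<integral>x. F (\<lambda>t. f (x t)) \<partial>distr M ?P (\<lambda>\<omega> t. X t \<omega>))"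
    using integral_distr[OF cadlag_process_path_measurable[OF X] G] by simp
  also have "\<dots> = (\<integral>\<omega>. F (\<lambda>t. f (Y t \<omega>)) \<partial>N)"
    unfolding markov_chain_law_unique[OF M N S]
    using integral_distr[OF cadlag_process_path_measurable[OF Y] G] by simp
  finally show ?thesis .
qed

section \<open>The infinite volume process\<close>

lemma eventually_at_right_le_iff:
  fixes a t :: ennreal
  shows "\<forall>\<^sub>F s in at_right t. a \<le> s \<longleftrightarrow> a \<le> t"
proof (cases "a \<le> t")
  case True
  then show ?thesis
    unfolding eventually_at_topological by (intro exI[of _ UNIV]) auto
next
  case False
  then show ?thesis
    unfolding eventually_at_topological by (intro exI[of _ "{..<a}"]) auto
qed

lemma eventually_at_left_le_iff:
  fixes a t :: ennreal
  shows "\<forall>\<^sub>F s in at_left t. a \<le> s \<longleftrightarrow> a < t"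
proof (cases "a < t")
  case True
  then show ?thesis
    unfolding eventually_at_topological by (intro exI[of _ "{a<..}"]) auto
next
  case False
  then show ?thesis
    unfolding eventually_at_topological by (intro exI[of _ UNIV]) auto
qed

text \<open>The predicate replaces comparison with the current time: \<open>a \<le> t\<close> gives
  the value and the right limit at \<open>t\<close>, and \<open>a < t\<close> gives the left
  limit.\<close>

definition pcf_config :: "'a ugraph \<Rightarrow> ('a \<Rightarrow> 'a) \<Rightarrow> ('a \<Rightarrow> nat) \<Rightarrow> (ennreal \<Rightarrow> bool) \<Rightarrow> ('a set \<Rightarrow> real) \<Rightarrow> 'a config" where
  "pcf_config H p d P w =
    (\<lambda>v\<in>verts H. if P (ennreal (freeze_time p d w v)) then Frozen else Warm,
     \<lambda>e\<in>edges H. P (ennreal (w e)) \<and> edge_opens p d w e)"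

lemma eventually_pcf_path:
  assumes H: "finite_graph H" and F: "\<And>a. \<forall>\<^sub>F s in F. a \<le> s \<longleftrightarrow> P a"
  shows "\<forall>\<^sub>F s in F. pcf_path H p d s w = pcf_config H p d P w"
proof -
  have "\<forall>\<^sub>F s in F. (\<forall>v\<in>verts H. ennreal (freeze_time p d w v) \<le> s \<longleftrightarrow> P (ennreal (freeze_time p d w v))) \<and>
      (\<forall>e\<in>edges H. ennreal (w e) \<le> s \<longleftrightarrow> P (ennreal (w e)))"
    using H F by (intro eventually_conj eventually_ball_finite) (auto simp: finite_graph_def)
  then show ?thesis
    by eventually_elim (auto simp: pcf_path_def pcf_config_def restrict_def fun_eq_iff)
qed

lemma pcf_path_eq_config: "pcf_path H p d t w = pcf_config H p d (\<lambda>a. a \<le> t) w"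
  by (simp add: pcf_path_def pcf_config_def)

lemma cadlag_pcf_path: "finite_graph H \<Longrightarrow> cadlag (\<lambda>t. pcf_path H p d t w)"
  unfolding cadlag_def
  using eventually_pcf_path[OF _ eventually_at_right_le_iff] eventually_pcf_path[OF _ eventually_at_left_le_iff]
  unfolding pcf_path_eq_config by blast

text \<open>Clocks and freezing times are real numbers, so being below \<infinity> and being at most
  \<infinity> mean the same for them.\<close>

lemma pcf_path_infinity:
  assumes "finite_graph H"
  shows "\<forall>\<^sub>F s in at_left \<infinity>. pcf_path H p d s w = pcf_path H p d \<infinity> w"
proof -
  have "\<forall>\<^sub>F s in at_left \<infinity>. pcf_path H p d s w = pcf_config H p d (\<lambda>a. a < \<infinity>) w"
    by (rule eventually_pcf_path[OF assms eventually_at_left_le_iff])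
  then show ?thesis by (simp add: pcf_path_def pcf_config_def)
qed

text \<open>An injective coding of the clocks by paths: the sample spaces are required to consist of paths.\<close>

definition encode_clocks :: "('a set \<Rightarrow> real) \<Rightarrow> 'a path" where
  "encode_clocks w = (\<lambda>t. (\<lambda>_. Warm, \<lambda>c. t = ennreal (exp (w c))))"

lemma inj_encode_clocks: "inj encode_clocks"
proof (rule injI, rule ext)
  fix w w' :: "'a set \<Rightarrow> real" and c
  assume "encode_clocks w = encode_clocks w'"
  \<comment> \<open>At this time the code of \<open>w\<close> answers True for \<open>c\<close>. The
    exponential is there because \<open>ennreal\<close> identifies all nonpositive reals.\<close>
  then have "snd (encode_clocks w (ennreal (exp (w c)))) c = snd (encode_clocks w' (ennreal (exp (w c)))) c"
    by simp
  then show "w c = w' c" by (simp add: encode_clocks_def)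
qed

definition path_measure :: "real \<Rightarrow> 'a path measure" where
  "path_measure \<alpha> = embed_measure (clock_measure (clock_rate \<alpha>)) encode_clocks"

definition pcf_process :: "'a ugraph \<Rightarrow> ('a \<Rightarrow> 'a) \<Rightarrow> ('a \<Rightarrow> nat) \<Rightarrow> ennreal \<Rightarrow> 'a path \<Rightarrow> 'a config" where
  "pcf_process H p d t \<omega> = pcf_path H p d t (inv encode_clocks \<omega>)"

lemma pcf_process_encode [simp]: "pcf_process H p d t (encode_clocks w) = pcf_path H p d t w"
  by (simp add: pcf_process_def inv_f_f inj_encode_clocks)

lemma space_path_measure: "space (path_measure \<alpha>) = range encode_clocks"
  by (simp add: path_measure_def space_embed_measure)

lemma measurable_encode_clocks: "encode_clocks \<in> clock_measure (clock_rate \<alpha>) \<rightarrow>\<^sub>M path_measure \<alpha>"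
  unfolding path_measure_def by (rule measurable_embed_measure2[OF inj_encode_clocks])

lemma path_measure_distr:
  "path_measure \<alpha> = distr (clock_measure (clock_rate \<alpha>)) (path_measure \<alpha>) encode_clocks"
  unfolding path_measure_def by (rule embed_measure_eq_distr[OF inj_encode_clocks])

lemma exponential_clocks_clock_rate: "\<alpha> > 0 \<Longrightarrow> exponential_clocks (clock_rate \<alpha>)"
  by unfold_locales (simp add: clock_rate_def)

lemma prob_space_path_measure: "\<alpha> > 0 \<Longrightarrow> prob_space (path_measure \<alpha>)"
proof -
  assume "\<alpha> > 0"
  then interpret exponential_clocks "clock_rate \<alpha> :: 'a set \<Rightarrow> real" by (rule exponential_clocks_clock_rate)
  show "prob_space (path_measure \<alpha> :: 'a path measure)"
    using prob_space_distr[OF measurable_encode_clocks] path_measure_distr by metis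
qed

lemma measurable_pcf_process:
  "pcf_path H p d t \<in> clock_measure (clock_rate \<alpha>) \<rightarrow>\<^sub>M N \<Longrightarrow> pcf_process H p d t \<in> path_measure \<alpha> \<rightarrow>\<^sub>M N"
  unfolding path_measure_def by (rule measurable_embed_measure1) simp

lemma cadlag_process_pcf:
  assumes "\<alpha> > 0" "simple_graph H" "finite_graph H"
  shows "cadlag_process (configs H) (path_measure \<alpha>) (pcf_process H p d)"
  unfolding cadlag_process_def
  using assms prob_space_path_measure pcf_path_measurable cadlag_pcf_path
  by (auto intro!: measurable_pcf_process simp: pcf_process_def)

lemma (in rooted_tree) PCF_process_pcf:
  assumes fin: "finite (verts T)" and \<alpha>: "\<alpha> > 0"
  shows "PCF_process T \<alpha> (path_measure \<alpha>) (pcf_process T p d)"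
proof -
  interpret clock_driven "clock_rate \<alpha>" "clocks T" "configs T" "\<lambda>t. pcf_path T p d (ennreal t)"
    jump "initial_config T" "PCF_rate T \<alpha>"
    by (rule clock_driven_pcf_path[OF fin \<alpha>])
  have fg: "finite_graph T" using fin finite_edges by (simp add: finite_graph_def)
  note cadlag = cadlag_process_pcf[OF \<alpha> simple fg, of p d]
  have init: "initial_config T \<in> configs T" by (simp add: initial_config_def configs_def)
  have fdd: "measure (path_measure \<alpha>) {\<omega> \<in> space (path_measure \<alpha>). \<forall>i\<le>k. pcf_process T p d (ennreal (t i)) \<omega> = x i} =
      transition_prob (configs T) (PCF_rate T \<alpha>) (t 0) (initial_config T) (x 0) *
      (\<Prod>i<k. transition_prob (configs T) (PCF_rate T \<alpha>) (t (Suc i) - t i) (x i) (x (Suc i)))"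
    if "0 \<le> t 0 \<and> (\<forall>i<k. t i \<le> t (Suc i)) \<and> (\<forall>i\<le>k. x i \<in> configs T)" for k and t :: "nat \<Rightarrow> real" and x
  proof -
    let ?A = "{\<omega> \<in> space (path_measure \<alpha>). \<forall>i\<le>k. pcf_process T p d (ennreal (t i)) \<omega> = x i}"
    have A: "?A \<in> sets (path_measure \<alpha>)"
      using cadlag_process_sets_finite[OF cadlag finite_atMost[of k], of "\<lambda>i y. y = x i" "\<lambda>i. ennreal (t i)"]
      unfolding Ball_def atMost_iff .
    have "measure (path_measure \<alpha>) ?A = prob (encode_clocks -` ?A \<inter> space \<Omega>)"
      by (subst path_measure_distr) (rule measure_distr[OF measurable_encode_clocks A])
    also have "encode_clocks -` ?A \<inter> space \<Omega> = {w. \<forall>i\<le>k. pcf_path T p d (ennreal (t i)) w = x i}"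
      by (auto simp: space_path_measure)
    finally show ?thesis using fdd[of t k x] that init by simp
  qed
  show ?thesis
    unfolding PCF_process_def markov_chain_def
    using cadlag fdd pcf_path_infinity[OF fg] by (simp add: pcf_process_def)
qed

lemma restrict_config_configs: "restrict_config L x \<in> configs L"
  by (simp add: restrict_config_def configs_def)

lemma subgraph_simple: "subgraph H G \<Longrightarrow> simple_graph H"
  by (simp add: subgraph_def)

lemma restrict_pcf_process:
  "subgraph L H \<Longrightarrow> restrict_config L (pcf_process H p d t \<omega>) = pcf_process L p d t \<omega>"
  by (simp add: pcf_process_def restrict_pcf_path subgraph_def)

section \<open>Exhaustion by subtrees through the root, and convergence in law\<close>

lemma (in rooted_tree) finite_climbs: "finite {u. climbs\<^sup>*\<^sup>* v u}"
proof (cases "v \<in> verts T")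
  case True
  then show ?thesis
  proof (induction v rule: depth_induct)
    case root
    have "{u. climbs\<^sup>*\<^sup>* r u} = {r}"
      using climbs_depth[of r] depth_root by auto
    then show ?case by simp
  next
    case (parent v)
    have "{u. climbs\<^sup>*\<^sup>* v u} \<subseteq> insert v {u. climbs\<^sup>*\<^sup>* (p v) u}"
    proof
      fix u assume "u \<in> {u. climbs\<^sup>*\<^sup>* v u}"
      then have "climbs\<^sup>*\<^sup>* v u" by simp
      then show "u \<in> insert v {u. climbs\<^sup>*\<^sup>* (p v) u}"
        by (cases rule: converse_rtranclpE) (auto simp: climbs_def[of v])
    qed
    then show ?case using parent.IH finite_subset by blast
  qed
next
  case False
  have "{u. climbs\<^sup>*\<^sup>* v u} \<subseteq> {v}"
  proof
    fix u assume "u \<in> {u. climbs\<^sup>*\<^sup>* v u}"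
    then have "climbs\<^sup>*\<^sup>* v u" by simp
    then show "u \<in> {v}"
      by (cases rule: converse_rtranclpE) (use False in \<open>auto simp: climbs_def[of v]\<close>)
  qed
  then show ?thesis by (rule finite_subset) simp
qed

text \<open>Countability of the tree enters here. Without an exhaustion the convergence property
  would be vacuous and could not single out the measure.\<close>

lemma (in rooted_tree) exists_rooted_exhaustion:
  assumes "countable (verts T)"
  obtains G where "exhaustion T G" "\<And>n. rooted_tree (G n) r p d" "\<And>n. finite (verts (G n))"
proof -
  define f where "f = from_nat_into (verts T)"
  have ne: "verts T \<noteq> {}" using root_in by auto
  have f_in: "f i \<in> verts T" for i unfolding f_def by (rule from_nat_into[OF ne])
  \<comment> \<open>Adding all ancestors closes the set under \<open>p\<close>, which makes the
    induced subgraph a tree through \<open>r\<close>. The enumeration \<open>f\<close> may repeat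
    vertices, so finite trees are covered.\<close>
  define V where "V n = insert r (\<Union>i\<le>n. {u. climbs\<^sup>*\<^sup>* (f i) u})" for n :: nat
  define G where "G n = \<lparr>verts = V n, edges = {{v, p v} |v. v \<in> V n \<and> v \<noteq> r}\<rparr>" for n
  have finV: "finite (V n)" for n unfolding V_def using finite_climbs by simp
  have climbs_in: "u \<in> verts T" if "climbs\<^sup>*\<^sup>* v u" "v \<in> verts T" for u v
    using that by (induction rule: rtranclp_induct) (auto simp: climbs_def parent_in)
  have VT: "V n \<subseteq> verts T" for n
    unfolding V_def using climbs_in f_in root_in by auto
  have pV: "p v \<in> V n" if "v \<in> V n" "v \<noteq> r" for v n
  proof -
    have "climbs v (p v)" using that VT by (auto simp: climbs_def)
    then show ?thesis using that unfolding V_def by (auto intro: rtranclp.rtrancl_into_rtrancl)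
  qed
  have rooted: "rooted_tree (G n) r p d" for n
  proof
    show "r \<in> verts (G n)" by (simp add: G_def V_def)
    show "d r = 0" by (rule depth_root)
    show "edges (G n) = {{v, p v} |v. v \<in> verts (G n) \<and> v \<noteq> r}" by (simp add: G_def)
    fix v assume v: "v \<in> verts (G n)" "v \<noteq> r"
    then show "p v \<in> verts (G n)" using pV by (simp add: G_def)
    show "d v = Suc (d (p v))" using v VT depth_parent[of v] by (auto simp: G_def)
  qed
  have simpleG: "simple_graph (G n)" for n using rooted_tree.simple[OF rooted] .
  have mono: "V n \<subseteq> V m" if "n \<le> m" for n m
    unfolding V_def using that by (auto intro: order_trans)
  have "exhaustion T G"
    unfolding exhaustion_def
  proof (intro conjI allI impI)
    fix n
    show "subgraph (G n) T" using simpleG VT[of n] by (auto simp: subgraph_def G_def edges_eq)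
    show "finite_graph (G n)"
      using rooted_tree.finite_edges[OF rooted] finV by (simp add: finite_graph_def G_def)
    show "connected_graph (G n)" by (rule rooted_tree.connected[OF rooted])
    show "subgraph (G n) (G (Suc n))"
      using simpleG mono[of n "Suc n"] by (auto simp: subgraph_def G_def)
  next
    fix L assume L: "subgraph L T \<and> finite_graph L"
    have "\<forall>v\<in>verts L. \<exists>i. v = f i"
      using L assms by (auto simp: subgraph_def f_def intro: from_nat_into_to_nat_on[symmetric])
    then obtain i where i: "\<And>v. v \<in> verts L \<Longrightarrow> v = f (i v)" by metis
    have "\<forall>\<^sub>F n in sequentially. \<forall>v\<in>verts L. i v \<le> n"
      using L by (intro eventually_ball_finite ballI eventually_ge_at_top) (simp add: finite_graph_def)
    then show "\<forall>\<^sub>F n in sequentially. subgraph L (G n)"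
    proof eventually_elim
      case (elim n)
      have vL: "verts L \<subseteq> V n"
      proof
        fix v assume "v \<in> verts L"
        then have "climbs\<^sup>*\<^sup>* (f (i v)) v" "i v \<le> n" using i[of v] elim by auto
        then show "v \<in> V n" unfolding V_def by auto
      qed
      have "e \<in> edges (G n)" if e: "e \<in> edges L" for e
      proof -
        have "e \<in> edges T" "e \<subseteq> V n" using L e vL by (auto simp: subgraph_def simple_graph_def)
        then show ?thesis by (auto simp: edges_eq G_def)
      qed
      then show ?case using L vL by (auto simp: subgraph_def G_def)
    qed
  qed
  then show ?thesis using that rooted finV by (simp add: G_def)
qed

theorem (in rooted_tree) infinite_volume_PCF_pcf:
  assumes \<alpha>: "\<alpha> > 0"
  shows "infinite_volume_PCF T \<alpha> (path_measure \<alpha>) (pcf_process T p d)"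
  unfolding infinite_volume_PCF_def
proof (intro conjI allI impI prob_space_path_measure \<alpha>)
  show "pcf_process T p d t \<in> path_measure \<alpha> \<rightarrow>\<^sub>M config_space T" for t
    by (intro measurable_pcf_process pcf_path_measurable_config_space simple)
next
  fix L G and N :: "nat \<Rightarrow> 'a path measure" and \<xi>
  assume *: "subgraph L T \<and> finite_graph L \<and> exhaustion T G \<and> (\<forall>n. PCF_process (G n) \<alpha> (N n) (\<xi> n))"
  then have L: "subgraph L T" "finite_graph L" and G: "exhaustion T G"
    and \<xi>: "\<And>n. PCF_process (G n) \<alpha> (N n) (\<xi> n)" by auto
  have restrict: "restrict_config L \<in> A \<rightarrow> configs L" for A by (simp add: restrict_config_configs)
  have cadlag_\<xi>: "cadlag_process (configs L) (N n) (\<lambda>t \<omega>. restrict_config L (\<xi> n t \<omega>))" for n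
    using \<xi>[of n] cadlag_process_comp[OF _ restrict] unfolding PCF_process_def markov_chain_def by blast
  have cadlag_\<eta>: "cadlag_process (configs L) (path_measure \<alpha>) (\<lambda>t \<omega>. restrict_config L (pcf_process T p d t \<omega>))"
    unfolding restrict_pcf_process[OF L(1)] by (rule cadlag_process_pcf[OF \<alpha> subgraph_simple[OF L(1)] L(2)])
  have "(\<lambda>n. \<integral>\<omega>. F (\<lambda>t. restrict_config L (\<xi> n t \<omega>)) \<partial>N n) \<longlonglongrightarrow>
      (\<integral>\<omega>. F (\<lambda>t. restrict_config L (pcf_process T p d t \<omega>)) \<partial>path_measure \<alpha>)"
    if F: "F \<in> borel_measurable (Pi\<^sub>M UNIV (\<lambda>_. count_space (configs L)))" for F :: "_ \<Rightarrow> real"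
  proof (rule tendsto_eventually)
    \<comment> \<open>The graph with the single vertex \<open>r\<close>: its eventual inclusion in
      \<open>G n\<close> makes the root available there.\<close>
    define R where "R = \<lparr>verts = {r}, edges = ({} :: 'a set set)\<rparr>"
    have "subgraph R T" "finite_graph R"
      by (auto simp: R_def subgraph_def simple_graph_def finite_graph_def root_in)
    then have "\<forall>\<^sub>F n in sequentially. subgraph R (G n)" "\<forall>\<^sub>F n in sequentially. subgraph L (G n)"
      using G L by (auto simp: exhaustion_def)
    then show "\<forall>\<^sub>F n in sequentially. (\<integral>\<omega>. F (\<lambda>t. restrict_config L (\<xi> n t \<omega>)) \<partial>N n) =
        (\<integral>\<omega>. F (\<lambda>t. restrict_config L (pcf_process T p d t \<omega>)) \<partial>path_measure \<alpha>)"
    proof eventually_elim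
      case (elim n)
      have Gn: "subgraph (G n) T" "finite_graph (G n)" "connected_graph (G n)" "r \<in> verts (G n)"
        using G elim by (auto simp: exhaustion_def subgraph_def R_def)
      interpret Gn: rooted_tree "G n" r p d
        by (rule connected_subgraph_rooted[OF Gn(1,3,4)])
      have fin: "finite (verts (G n))" using Gn(2) by (simp add: finite_graph_def)
      \<comment> \<open>\<open>\<xi> n\<close> is an arbitrary PCF process on \<open>G n\<close>;
        uniqueness in law puts in its place the one built from the same clocks, \<open>p\<close> and
        \<open>d\<close> as the limit.\<close>
      have "(\<integral>\<omega>. F (\<lambda>t. restrict_config L (\<xi> n t \<omega>)) \<partial>N n) =
          (\<integral>\<omega>. F (\<lambda>t. restrict_config L (pcf_process (G n) p d t \<omega>)) \<partial>path_measure \<alpha>)"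
        using \<xi>[of n] Gn.PCF_process_pcf[OF fin \<alpha>] unfolding PCF_process_def
        by (rule markov_chain_integral_eq[OF _ _ finite_configs[OF Gn(2)] restrict F])
      then show ?case unfolding restrict_pcf_process[OF L(1)] restrict_pcf_process[OF elim(2)] .
    qed
  qed
  then show "converges_in_law (configs L) N (\<lambda>n t \<omega>. restrict_config L (\<xi> n t \<omega>))
      (path_measure \<alpha>) (\<lambda>t \<omega>. restrict_config L (pcf_process T p d t \<omega>))"
    unfolding converges_in_law_def using cadlag_\<xi> cadlag_\<eta> by blast
qed

section \<open>Uniqueness of the law of the final edge configuration\<close>

lemma strict_mono_surj_infinity:
  fixes f :: "ennreal \<Rightarrow> ennreal"
  assumes "strict_mono f" "surj f" shows "f \<infinity> = \<infinity>"
proof -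
  obtain t where "f t = \<infinity>" using assms(2) by (metis surjD)
  then have "\<infinity> \<le> f \<infinity>" using strict_mono_leD[OF assms(1), of t \<infinity>] by simp
  then show ?thesis by (simp add: top.extremum_unique)
qed

text \<open>Evaluation at a time strictly between 0 and \<infinity> is in general not J1-continuous.
  An increasing bijection of the time interval fixes \<infinity>, however, so final states agree as
  soon as the paths agree up to a time change.\<close>

lemma skorokhod_continuous_final: "skorokhod_continuous S (\<lambda>x. f (x \<infinity>))"
  unfolding skorokhod_continuous_def
proof (intro allI impI)
  fix xs x assume "(\<forall>n. cadlag (xs n) \<and> range (xs n) \<subseteq> S) \<and> cadlag x \<and> range x \<subseteq> S \<and> skorokhod_tendsto xs x"
  then obtain \<tau> where \<tau>: "\<And>n. strict_mono (\<tau> n)" "\<And>n. surj (\<tau> n)"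
    and ev: "\<forall>\<^sub>F n in sequentially. \<forall>t. xs n (\<tau> n t) = x t"
    unfolding skorokhod_tendsto_def by blast
  from ev have "\<forall>\<^sub>F n in sequentially. f (xs n \<infinity>) = f (x \<infinity>)"
  proof eventually_elim
    case (elim n)
    then have "xs n (\<tau> n \<infinity>) = x \<infinity>" by blast
    then show ?case using strict_mono_surj_infinity[OF \<tau>] by simp
  qed
  then show "(\<lambda>n. f (xs n \<infinity>)) \<longlonglongrightarrow> f (x \<infinity>)" by (rule tendsto_eventually)
qed

text \<open>The event is tested on the finite graph formed by the edges in \<open>J\<close> and
  their ends. The left side mentions finite volumes only, so one exhaustion with its PCF processes
  determines the final edge marginals of \<open>\<eta>\<close>.\<close>

lemma infinite_volume_PCF_final_tendsto:
  fixes T :: "'a ugraph" and N :: "nat \<Rightarrow> 'a path measure"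
  assumes T: "simple_graph T" and inf: "infinite_volume_PCF T \<alpha> M \<eta>" and G: "exhaustion T G"
    and N: "\<And>n. PCF_process (G n) \<alpha> (N n) (\<xi> n)"
    and J: "finite J" "J \<subseteq> edges T"
  shows "(\<lambda>n. \<integral>\<omega>. of_bool (\<forall>e\<in>J. snd (restrict_config \<lparr>verts = \<Union>J, edges = J\<rparr> (\<xi> n \<infinity> \<omega>)) e \<in> A e) \<partial>N n)
    \<longlonglongrightarrow> measure M {\<omega> \<in> space M. \<forall>e\<in>J. snd (\<eta> \<infinity> \<omega>) e \<in> A e}"
proof -
  let ?L = "\<lparr>verts = \<Union>J, edges = J\<rparr>"
  define F where "F x = (of_bool (\<forall>e\<in>J. snd (x \<infinity> :: 'a config) e \<in> A e) :: real)" for x :: "'a path"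
  have J2: "e \<subseteq> verts T \<and> card e = 2" if "e \<in> J" for e
    using T J that by (auto simp: simple_graph_def)
  have L: "subgraph ?L T" "finite_graph ?L"
  proof -
    have "finite e" if "e \<in> J" for e using J2[OF that] by (auto intro: card_ge_0_finite)
    then show "finite_graph ?L" using J by (simp add: finite_graph_def)
    show "subgraph ?L T" using J J2 by (auto simp: subgraph_def simple_graph_def)
  qed
  then have conv: "converges_in_law (configs ?L) N (\<lambda>n t \<omega>. restrict_config ?L (\<xi> n t \<omega>))
      M (\<lambda>t \<omega>. restrict_config ?L (\<eta> t \<omega>))"
    using inf G N unfolding infinite_volume_PCF_def by blast
  have mF: "F \<in> borel_measurable (Pi\<^sub>M UNIV (\<lambda>_. count_space (configs ?L)))"
    unfolding F_def
    by (rule measurable_compose[OF measurable_component_singleton[of \<infinity> UNIV]]) auto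
  have "bounded (range F)"
    by (rule boundedI[of _ 1]) (auto simp: F_def)
  moreover have "skorokhod_continuous (configs ?L) F"
    unfolding F_def by (rule skorokhod_continuous_final)
  ultimately have "(\<lambda>n. \<integral>\<omega>. F (\<lambda>t. restrict_config ?L (\<xi> n t \<omega>)) \<partial>N n) \<longlonglongrightarrow>
      (\<integral>\<omega>. F (\<lambda>t. restrict_config ?L (\<eta> t \<omega>)) \<partial>M)"
    using conv mF unfolding converges_in_law_def by blast
  moreover have "(\<integral>\<omega>. F (\<lambda>t. restrict_config ?L (\<eta> t \<omega>)) \<partial>M) =
      measure M {\<omega> \<in> space M. \<forall>e\<in>J. snd (\<eta> \<infinity> \<omega>) e \<in> A e}"
  proof -
    have cad: "cadlag_process (configs ?L) M (\<lambda>t \<omega>. restrict_config ?L (\<eta> t \<omega>))"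
      using conv by (simp add: converges_in_law_def)
    have eq: "(\<forall>e\<in>J. snd (restrict_config ?L y) e \<in> A e) \<longleftrightarrow> (\<forall>e\<in>J. snd y e \<in> A e)" for y
      by (auto simp: restrict_config_def)
    interpret prob_space M using cadlag_process_prob_space[OF cad] .
    have "{\<omega> \<in> space M. \<forall>e\<in>J. snd (\<eta> \<infinity> \<omega>) e \<in> A e} \<in> sets M"
      using cadlag_process_sets[OF cad, of "\<lambda>y. \<forall>e\<in>J. snd y e \<in> A e" \<infinity>] unfolding eq .
    moreover have "(\<integral>\<omega>. F (\<lambda>t. restrict_config ?L (\<eta> t \<omega>)) \<partial>M) =
        (\<integral>\<omega>. indicator {\<omega> \<in> space M. \<forall>e\<in>J. snd (\<eta> \<infinity> \<omega>) e \<in> A e} \<omega> \<partial>M)"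
      unfolding F_def eq by (intro Bochner_Integration.integral_cong) (auto simp: indicator_def)
    ultimately show ?thesis by simp
  qed
  ultimately show ?thesis by (simp add: F_def)
qed

lemma infinite_volume_PCF_final_measurable:
  assumes "infinite_volume_PCF T \<alpha> M \<eta>"
  shows "(\<lambda>\<omega>. snd (\<eta> \<infinity> \<omega>)) \<in> M \<rightarrow>\<^sub>M edge_space T"
proof -
  have "\<eta> \<infinity> \<in> M \<rightarrow>\<^sub>M config_space T" using assms by (simp add: infinite_volume_PCF_def)
  then show ?thesis unfolding config_space_def by measurable
qed

text \<open>Both candidates arise as limits of the same finite-volume processes along the same
  exhaustion, so they agree on cylinders, which determine a measure on
  \<open>edge_space T\<close>.\<close>

lemma PCF_measure_unique:
  assumes tree: "tree T" "countable (verts T)" and \<alpha>: "\<alpha> > 0"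
    and \<mu>: "PCF_measure T \<alpha> \<mu>" and \<nu>: "PCF_measure T \<alpha> \<nu>"
  shows "\<mu> = \<nu>"
proof -
  obtain r where r: "r \<in> verts T" using tree by (auto simp: tree_def connected_graph_def)
  obtain p d where "rooted_tree T r p d" using tree_rooted[OF tree(1) r] .
  then interpret rooted_tree T r p d .
  obtain G where G: "exhaustion T G" "\<And>n. rooted_tree (G n) r p d" "\<And>n. finite (verts (G n))"
    using exists_rooted_exhaustion[OF tree(2)] by blast
  have N: "PCF_process (G n) \<alpha> (path_measure \<alpha>) (pcf_process (G n) p d)" for n
    by (rule rooted_tree.PCF_process_pcf[OF G(2,3) \<alpha>])
  obtain M \<eta> where M: "infinite_volume_PCF T \<alpha> (M :: 'a path measure) \<eta>"
    "\<mu> = distr M (edge_space T) (\<lambda>\<omega>. snd (\<eta> \<infinity> \<omega>))" using \<mu> by (auto simp: PCF_measure_def)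
  obtain M' \<eta>' where M': "infinite_volume_PCF T \<alpha> (M' :: 'a path measure) \<eta>'"
    "\<nu> = distr M' (edge_space T) (\<lambda>\<omega>. snd (\<eta>' \<infinity> \<omega>))" using \<nu> by (auto simp: PCF_measure_def)
  note mM = infinite_volume_PCF_final_measurable[OF M(1)]
    and mM' = infinite_volume_PCF_final_measurable[OF M'(1)]
  interpret M: prob_space M using M(1) by (simp add: infinite_volume_PCF_def)
  interpret M': prob_space M' using M'(1) by (simp add: infinite_volume_PCF_def)
  have vimage: "(\<lambda>\<omega>. snd (\<zeta> \<infinity> \<omega>)) -` prod_emb (edges T) (\<lambda>_. count_space UNIV) J (Pi\<^sub>E J A) \<inter> space K =
      {\<omega> \<in> space K. \<forall>e\<in>J. snd (\<zeta> \<infinity> \<omega>) e \<in> A e}"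
    if "infinite_volume_PCF T \<alpha> K \<zeta>" "J \<subseteq> edges T" for K :: "'a path measure" and \<zeta> J A
  proof -
    \<comment> \<open>Measurability into \<open>edge_space T\<close> includes that the values are
      extensional, as membership in an embedded cylinder requires.\<close>
    have "snd (\<zeta> \<infinity> \<omega>) \<in> extensional (edges T)" if "\<omega> \<in> space K" for \<omega>
      using measurable_space[OF infinite_volume_PCF_final_measurable[OF \<open>infinite_volume_PCF T \<alpha> K \<zeta>\<close>] that]
      by (auto simp: edge_space_def space_PiM PiE_def)
    then show ?thesis by (auto simp: prod_emb_iff restrict_PiE_iff)
  qed
  show ?thesis
  proof (rule measure_eqI_PiM_infinite)
    show "sets \<mu> = sets (\<Pi>\<^sub>M e\<in>edges T. count_space UNIV)" "sets \<nu> = sets (\<Pi>\<^sub>M e\<in>edges T. count_space UNIV)"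
      by (simp_all add: M(2) M'(2) edge_space_def)
    show "finite_measure \<mu>" unfolding M(2) using M.prob_space_distr[OF mM] by (rule prob_space.finite_measure)
    fix A J assume J: "finite J" "J \<subseteq> edges T" and A: "\<And>e. e \<in> J \<Longrightarrow> A e \<in> sets (count_space (UNIV :: bool set))"
    let ?B = "prod_emb (edges T) (\<lambda>_. count_space UNIV) J (Pi\<^sub>E J A)"
    have B: "?B \<in> sets (edge_space T)" unfolding edge_space_def using J A by (intro sets_PiM_I) auto
    have "measure M {\<omega> \<in> space M. \<forall>e\<in>J. snd (\<eta> \<infinity> \<omega>) e \<in> A e} =
        measure M' {\<omega> \<in> space M'. \<forall>e\<in>J. snd (\<eta>' \<infinity> \<omega>) e \<in> A e}"
      using infinite_volume_PCF_final_tendsto[OF simple M(1) G(1) N J, of A]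
        infinite_volume_PCF_final_tendsto[OF simple M'(1) G(1) N J, of A] by (rule LIMSEQ_unique)
    then show "emeasure \<mu> ?B = emeasure \<nu> ?B"
      unfolding M(2) M'(2) emeasure_distr[OF mM B] emeasure_distr[OF mM' B]
        vimage[OF M(1) J(2)] vimage[OF M'(1) J(2)] M.emeasure_eq_measure M'.emeasure_eq_measure by simp
  qed
qed

theorem theorem2p21:
  fixes T :: "'a ugraph" and \<alpha> :: real
  assumes "tree T" and "countable (verts T)" and "\<alpha> > 0"
  shows "(\<exists>(M :: 'a path measure) \<eta>. infinite_volume_PCF T \<alpha> M \<eta>) \<and>
         (\<exists>!\<mu>. PCF_measure T \<alpha> \<mu>)"
proof -
  obtain r where r: "r \<in> verts T" using assms(1) by (auto simp: tree_def connected_graph_def)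
  obtain p d where "rooted_tree T r p d" using tree_rooted[OF assms(1) r] .
  then have inf: "infinite_volume_PCF T \<alpha> (path_measure \<alpha>) (pcf_process T p d)"
    using assms(3) by (rule rooted_tree.infinite_volume_PCF_pcf)
  then have "PCF_measure T \<alpha> (distr (path_measure \<alpha>) (edge_space T) (\<lambda>\<omega>. snd (pcf_process T p d \<infinity> \<omega>)))"
    unfolding PCF_measure_def by blast
  then show ?thesis using inf PCF_measure_unique[OF assms] by blast
qed

end
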